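(* Let $n\ge 1$. Let $A$ be an object of a braided strict monoidal category with twist $\tau$, and for $1\le i<n$ define $\sigma_i:A^n\to A^n$ by $\sigma_i=1_{A^{i-1}}\otimes\tau_{A,A}\otimes 1_{A^{n-i-1}}$. Then these arrows satisfy the equations of the braid group $\mathbf{B}_n$: $\sigma_i\sigma_j=\sigma_j\sigma_i$ if $i+1<j$, and $\sigma_i\sigma_{i+1}\sigma_i=\sigma_{i+1}\sigma_i\sigma_{i+1}$. In particular this holds for the generating object $A$ of $\mathbf{Tangle}_n$. The elements $S\sigma_iR$ ($1\le i<n$) of the blocked-braid group $\mathbf{BB}_n$ also satisfy these equations, and hence there is a surjective group homomorphism $\mathbf{B}_n\to\mathbf{BB}_n$ (sending the generator $\sigma_i$ to $S\sigma_iR$).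
   Context: Composition of arrows is written by juxtaposition, $fg$ meaning first $g$, then $f$. A braided strict monoidal category is a category with a strictly associative and unitary tensor functor $\otimes$ with unit $I$, and a natural family of isomorphisms (twist) $\tau_{A,B}:A\otimes B\to B\otimes A$ such that $\tau_{A,B\otimes C}=(1_B\otimes\tau_{A,C})(\tau_{A,B}\otimes 1_C)$ and $\tau_{A\otimes B,C}=(\tau_{A,C}\otimes 1_B)(1_A\otimes\tau_{B,C})$. $A^n$ denotes the $n$-fold tensor power of $A$. A tangle algebra in such a category is an object $A$ with arrows $\eta:I\to A\otimes A$ and $\epsilon:A\otimes A\to I$ satisfying $(\epsilon\otimes 1_A)(1_A\otimes\eta)=1_A=(1_A\otimes\epsilon)(\eta\otimes 1_A)$, $\epsilon\tau_{A,A}=\epsilon$ and $\tau_{A,A}\eta=\eta$. $\mathbf{Tangle}_n$ is the free braided strict monoidal category generated by an object $A$ with a tangle algebra structure and two arrows $R:I\to A^n$ and $S:A^n\to I$ (subject to no further equations). A braid in $\mathbf{Tangle}_n$ is an arrow $B:A^n\to A^n$ that is a composite of arrows each of which is a tensor of identities and arrows $\tau_{A,A}$ or $\tau_{A,A}^{-1}$. A blocked braid on $n$ strings is an arrow $I\to I$ of $\mathbf{Tangle}_n$ of the form $SBR$ with $B$ a braid; equality of blocked braids is equality of arrows in $\mathbf{Tangle}_n$. The blocked-braid group $\mathbf{BB}_n$ has as elements the blocked braids on $n$ strings, identity $S1_{A^n}R$, product $(SBR)(SB'R)=SBB'R$ and inverse $(SBR)^{-1}=SB^{-1}R$ (these operations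 are well defined). Artin's braid group $\mathbf{B}_n$ is generated by $\sigma_1,\dots,\sigma_{n-1}$ subject to $\sigma_i\sigma_j=\sigma_j\sigma_i$ if $i+1<j$ and $\sigma_i\sigma_{i+1}\sigma_i=\sigma_{i+1}\sigma_i\sigma_{i+1}$. *)

theory Defs
  imports "HOL-Algebra.Group"
begin

section \<open>Braided strict monoidal categories\<close>

text \<open>Composition \<open>f \<cdot> g\<close> means first \<open>g\<close>, then \<open>f\<close>.\<close>

record ('o, 'a) braided_data =
  Ob :: "'o set"
  Ar :: "'a set"
  src :: "'a \<Rightarrow> 'o"
  tgt :: "'a \<Rightarrow> 'o"
  ident :: "'o \<Rightarrow> 'a"
  cmp :: "'a \<Rightarrow> 'a \<Rightarrow> 'a" (infixr \<open>\<cdot>\<index>\<close> 65)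
  unit_ob :: "'o"
  tensor_ob :: "'o \<Rightarrow> 'o \<Rightarrow> 'o" (infixr \<open>\<odot>\<index>\<close> 75)
  tensor_ar :: "'a \<Rightarrow> 'a \<Rightarrow> 'a" (infixr \<open>\<star>\<index>\<close> 75)
  twist :: "'o \<Rightarrow> 'o \<Rightarrow> 'a"

definition arrows :: "('o, 'a, 'm) braided_data_scheme \<Rightarrow> 'o \<Rightarrow> 'o \<Rightarrow> 'a set" where
  "arrows C X Y = {f \<in> Ar C. src C f = X \<and> tgt C f = Y}"

definition inverse_arrows :: "('o, 'a, 'm) braided_data_scheme \<Rightarrow> 'a \<Rightarrow> 'a \<Rightarrow> bool" where
  "inverse_arrows C f g \<longleftrightarrow>
     f \<in> Ar C \<and> g \<in> arrows C (tgt C f) (src C f) \<and>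
     cmp C g f = ident C (src C f) \<and> cmp C f g = ident C (tgt C f)"

definition inv_arrow :: "('o, 'a, 'm) braided_data_scheme \<Rightarrow> 'a \<Rightarrow> 'a" where
  "inv_arrow C f = (THE g. inverse_arrows C f g)"

locale category =
  fixes C (structure)
  assumes src_closed: "f \<in> Ar C \<Longrightarrow> src C f \<in> Ob C"
    and tgt_closed: "f \<in> Ar C \<Longrightarrow> tgt C f \<in> Ob C"
    and ident_closed: "X \<in> Ob C \<Longrightarrow> ident C X \<in> arrows C X X"
    and cmp_closed: "\<lbrakk>g \<in> arrows C X Y; f \<in> arrows C Y Z\<rbrakk> \<Longrightarrow> f \<cdot> g \<in> arrows C X Z"
    and cmp_ident: "f \<in> arrows C X Y \<Longrightarrow> f \<cdot> ident C X = f"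
    and ident_cmp: "f \<in> arrows C X Y \<Longrightarrow> ident C Y \<cdot> f = f"
    and cmp_assoc: "\<lbrakk>h \<in> arrows C W X; g \<in> arrows C X Y; f \<in> arrows C Y Z\<rbrakk>
          \<Longrightarrow> (f \<cdot> g) \<cdot> h = f \<cdot> (g \<cdot> h)"

locale strict_monoidal_category = category +
  assumes unit_closed: "unit_ob C \<in> Ob C"
    and tensor_ob_closed: "\<lbrakk>X \<in> Ob C; Y \<in> Ob C\<rbrakk> \<Longrightarrow> X \<odot> Y \<in> Ob C"
    and tensor_ob_assoc: "\<lbrakk>X \<in> Ob C; Y \<in> Ob C; Z \<in> Ob C\<rbrakk> \<Longrightarrow> (X \<odot> Y) \<odot> Z = X \<odot> (Y \<odot> Z)"
    and tensor_ob_unit: "X \<in> Ob C \<Longrightarrow> X \<odot> unit_ob C = X"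
    and unit_tensor_ob: "X \<in> Ob C \<Longrightarrow> unit_ob C \<odot> X = X"
    and tensor_ar_closed: "\<lbrakk>f \<in> arrows C X X'; g \<in> arrows C Y Y'\<rbrakk>
          \<Longrightarrow> f \<star> g \<in> arrows C (X \<odot> Y) (X' \<odot> Y')"
    and tensor_ident: "\<lbrakk>X \<in> Ob C; Y \<in> Ob C\<rbrakk> \<Longrightarrow> ident C X \<star> ident C Y = ident C (X \<odot> Y)"
    and tensor_cmp: "\<lbrakk>f \<in> arrows C X Y; f' \<in> arrows C Y Z; g \<in> arrows C X' Y'; g' \<in> arrows C Y' Z'\<rbrakk>
          \<Longrightarrow> (f' \<cdot> f) \<star> (g' \<cdot> g) = (f' \<star> g') \<cdot> (f \<star> g)"
    and tensor_ar_assoc: "\<lbrakk>f \<in> Ar C; g \<in> Ar C; h \<in> Ar C\<rbrakk> \<Longrightarrow> (f \<star> g) \<star> h = f \<star> (g \<star> h)"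
    and tensor_ar_unit: "f \<in> Ar C \<Longrightarrow> f \<star> ident C (unit_ob C) = f"
    and unit_tensor_ar: "f \<in> Ar C \<Longrightarrow> ident C (unit_ob C) \<star> f = f"

locale braided_strict_monoidal_category = strict_monoidal_category +
  assumes twist_closed: "\<lbrakk>X \<in> Ob C; Y \<in> Ob C\<rbrakk> \<Longrightarrow> twist C X Y \<in> arrows C (X \<odot> Y) (Y \<odot> X)"
    and twist_iso: "\<lbrakk>X \<in> Ob C; Y \<in> Ob C\<rbrakk> \<Longrightarrow> \<exists>g. inverse_arrows C (twist C X Y) g"
    and twist_natural: "\<lbrakk>f \<in> arrows C X X'; g \<in> arrows C Y Y'\<rbrakk>
          \<Longrightarrow> twist C X' Y' \<cdot> (f \<star> g) = (g \<star> f) \<cdot> twist C X Y"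
    and twist_tensor_right: "\<lbrakk>X \<in> Ob C; Y \<in> Ob C; Z \<in> Ob C\<rbrakk>
          \<Longrightarrow> twist C X (Y \<odot> Z) = (ident C Y \<star> twist C X Z) \<cdot> (twist C X Y \<star> ident C Z)"
    and twist_tensor_left: "\<lbrakk>X \<in> Ob C; Y \<in> Ob C; Z \<in> Ob C\<rbrakk>
          \<Longrightarrow> twist C (X \<odot> Y) Z = (twist C X Z \<star> ident C Y) \<cdot> (ident C X \<star> twist C Y Z)"

primrec tensor_power :: "('o, 'a, 'm) braided_data_scheme \<Rightarrow> 'o \<Rightarrow> nat \<Rightarrow> 'o" where
  "tensor_power C A 0 = unit_ob C"
| "tensor_power C A (Suc k) = tensor_ob C (tensor_power C A k) A"

definition sigma :: "('o, 'a, 'm) braided_data_scheme \<Rightarrow> 'o \<Rightarrow> nat \<Rightarrow> nat \<Rightarrow> 'a" where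
  "sigma C A n i =
     tensor_ar C (ident C (tensor_power C A (i - 1)))
       (tensor_ar C (twist C A A) (ident C (tensor_power C A (n - i - 1))))"

definition braid_equations :: "('b \<Rightarrow> 'b \<Rightarrow> 'b) \<Rightarrow> nat \<Rightarrow> (nat \<Rightarrow> 'b) \<Rightarrow> bool" where
  "braid_equations m n s \<longleftrightarrow>
     (\<forall>i j. 1 \<le> i \<and> i + 1 < j \<and> j < n \<longrightarrow> m (s i) (s j) = m (s j) (s i)) \<and>
     (\<forall>i. 1 \<le> i \<and> i + 1 < n \<longrightarrow>
        m (m (s i) (s (i + 1))) (s i) = m (m (s (i + 1)) (s i)) (s (i + 1)))"

definition tangle_algebra :: "('o, 'a, 'm) braided_data_scheme \<Rightarrow> 'o \<Rightarrow> 'a \<Rightarrow> 'a \<Rightarrow> bool" where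
  "tangle_algebra C A \<eta> \<epsilon> \<longleftrightarrow>
     A \<in> Ob C \<and>
     \<eta> \<in> arrows C (unit_ob C) (tensor_ob C A A) \<and>
     \<epsilon> \<in> arrows C (tensor_ob C A A) (unit_ob C) \<and>
     cmp C (tensor_ar C \<epsilon> (ident C A)) (tensor_ar C (ident C A) \<eta>) = ident C A \<and>
     cmp C (tensor_ar C (ident C A) \<epsilon>) (tensor_ar C \<eta> (ident C A)) = ident C A \<and>
     cmp C \<epsilon> (twist C A A) = \<epsilon> \<and>
     cmp C (twist C A A) \<eta> = \<eta>"


section \<open>The free category on a tangle algebra with \<open>R : I \<rightarrow> A\<^sup>n\<close> and \<open>S : A\<^sup>n \<rightarrow> I\<close>\<close>

text \<open>The objects form the free monoid on the generator \<open>A\<close>: the object \<open>A\<^sup>k\<close> is represented by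
  \<open>k\<close>, so \<open>I\<close> is \<open>0\<close>, \<open>A\<close> is \<open>1\<close> and the tensor product is addition. Arrows are well-typed terms
  modulo the smallest congruence containing the required equations; the universal property
  is \<open>tangle_free\<close> below.\<close>

datatype tangle_term =
    IdT nat
  | CmpT tangle_term tangle_term
  | TensT tangle_term tangle_term
  | TwT nat nat
  | TwInvT nat nat
  | EtaT
  | EpsT
  | RT
  | ST

inductive tangle_type :: "nat \<Rightarrow> tangle_term \<Rightarrow> nat \<Rightarrow> nat \<Rightarrow> bool" for n where
  "tangle_type n (IdT k) k k"
| "\<lbrakk>tangle_type n g k l; tangle_type n f l m\<rbrakk> \<Longrightarrow> tangle_type n (CmpT f g) k m"
| "\<lbrakk>tangle_type n f k l; tangle_type n g k' l'\<rbrakk> \<Longrightarrow> tangle_type n (TensT f g) (k + k') (l + l')"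
| "tangle_type n (TwT k l) (k + l) (l + k)"
| "tangle_type n (TwInvT k l) (l + k) (k + l)"
| "tangle_type n EtaT 0 2"
| "tangle_type n EpsT 2 0"
| "tangle_type n RT 0 n"
| "tangle_type n ST n 0"

inductive tangle_eq :: "nat \<Rightarrow> tangle_term \<Rightarrow> tangle_term \<Rightarrow> bool" for n where
  refl: "tangle_type n f k l \<Longrightarrow> tangle_eq n f f"
| sym: "tangle_eq n f g \<Longrightarrow> tangle_eq n g f"
| trans: "\<lbrakk>tangle_eq n f g; tangle_eq n g h\<rbrakk> \<Longrightarrow> tangle_eq n f h"
| cmp_cong: "\<lbrakk>tangle_eq n f f'; tangle_eq n g g'; tangle_type n g k l; tangle_type n f l m\<rbrakk>
    \<Longrightarrow> tangle_eq n (CmpT f g) (CmpT f' g')"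
| tens_cong: "\<lbrakk>tangle_eq n f f'; tangle_eq n g g'\<rbrakk> \<Longrightarrow> tangle_eq n (TensT f g) (TensT f' g')"
| cmp_id: "tangle_type n f k l \<Longrightarrow> tangle_eq n (CmpT f (IdT k)) f"
| id_cmp: "tangle_type n f k l \<Longrightarrow> tangle_eq n (CmpT (IdT l) f) f"
| cmp_assoc: "\<lbrakk>tangle_type n h k l; tangle_type n g l m; tangle_type n f m p\<rbrakk>
    \<Longrightarrow> tangle_eq n (CmpT (CmpT f g) h) (CmpT f (CmpT g h))"
| tens_id: "tangle_eq n (TensT (IdT k) (IdT l)) (IdT (k + l))"
| tens_cmp: "\<lbrakk>tangle_type n f k l; tangle_type n f' l m; tangle_type n g k' l'; tangle_type n g' l' m'\<rbrakk>
    \<Longrightarrow> tangle_eq n (TensT (CmpT f' f) (CmpT g' g)) (CmpT (TensT f' g') (TensT f g))"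
| tens_assoc: "\<lbrakk>tangle_type n f k l; tangle_type n g k' l'; tangle_type n h k'' l''\<rbrakk>
    \<Longrightarrow> tangle_eq n (TensT (TensT f g) h) (TensT f (TensT g h))"
| tens_unit: "tangle_type n f k l \<Longrightarrow> tangle_eq n (TensT f (IdT 0)) f"
| unit_tens: "tangle_type n f k l \<Longrightarrow> tangle_eq n (TensT (IdT 0) f) f"
| inv_tw: "tangle_eq n (CmpT (TwInvT k l) (TwT k l)) (IdT (k + l))"
| tw_inv: "tangle_eq n (CmpT (TwT k l) (TwInvT k l)) (IdT (l + k))"
| tw_natural: "\<lbrakk>tangle_type n f k l; tangle_type n g k' l'\<rbrakk>
    \<Longrightarrow> tangle_eq n (CmpT (TwT l l') (TensT f g)) (CmpT (TensT g f) (TwT k k'))"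
| tw_right: "tangle_eq n (TwT k (l + m)) (CmpT (TensT (IdT l) (TwT k m)) (TensT (TwT k l) (IdT m)))"
| tw_left: "tangle_eq n (TwT (k + l) m) (CmpT (TensT (TwT k m) (IdT l)) (TensT (IdT k) (TwT l m)))"
| snake1: "tangle_eq n (CmpT (TensT EpsT (IdT 1)) (TensT (IdT 1) EtaT)) (IdT 1)"
| snake2: "tangle_eq n (CmpT (TensT (IdT 1) EpsT) (TensT EtaT (IdT 1))) (IdT 1)"
| eps_tw: "tangle_eq n (CmpT EpsT (TwT 1 1)) EpsT"
| tw_eta: "tangle_eq n (CmpT (TwT 1 1) EtaT) EtaT"

definition tangle_class :: "nat \<Rightarrow> tangle_term \<Rightarrow> tangle_term set" where
  "tangle_class n t = {u. tangle_eq n t u}"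

definition Tangle :: "nat \<Rightarrow> (nat, tangle_term set) braided_data" where
  "Tangle n =
    \<lparr> Ob = UNIV,
      Ar = {tangle_class n t |t k l. tangle_type n t k l},
      src = (\<lambda>f. THE k. \<exists>t\<in>f. \<exists>l. tangle_type n t k l),
      tgt = (\<lambda>f. THE l. \<exists>t\<in>f. \<exists>k. tangle_type n t k l),
      ident = (\<lambda>k. tangle_class n (IdT k)),
      cmp = (\<lambda>f g. \<Union>s\<in>f. \<Union>t\<in>g. tangle_class n (CmpT s t)),
      unit_ob = 0,
      tensor_ob = (+),
      tensor_ar = (\<lambda>f g. \<Union>s\<in>f. \<Union>t\<in>g. tangle_class n (TensT s t)),
      twist = (\<lambda>k l. tangle_class n (TwT k l)) \<rparr>"

definition Tangle_R :: "nat \<Rightarrow> tangle_term set" where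
  "Tangle_R n = tangle_class n RT"

definition Tangle_S :: "nat \<Rightarrow> tangle_term set" where
  "Tangle_S n = tangle_class n ST"


section \<open>Braids and blocked braids\<close>

text \<open>Every object of \<open>Tangle n\<close> is a tensor power of \<open>A\<close>, so there the identities below are
  all identities.\<close>

inductive_set braid_layers :: "('o, 'a, 'm) braided_data_scheme \<Rightarrow> 'o \<Rightarrow> 'a set" for C A where
  "ident C (tensor_power C A k) \<in> braid_layers C A"
| "twist C A A \<in> braid_layers C A"
| "inv_arrow C (twist C A A) \<in> braid_layers C A"
| "\<lbrakk>f \<in> braid_layers C A; g \<in> braid_layers C A\<rbrakk> \<Longrightarrow> tensor_ar C f g \<in> braid_layers C A"

inductive_set braid_composites :: "('o, 'a, 'm) braided_data_scheme \<Rightarrow> 'o \<Rightarrow> 'a set" for C A where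
  "f \<in> braid_layers C A \<Longrightarrow> f \<in> braid_composites C A"
| "\<lbrakk>f \<in> braid_composites C A; g \<in> braid_composites C A; src C f = tgt C g\<rbrakk>
    \<Longrightarrow> cmp C f g \<in> braid_composites C A"

definition braids :: "nat \<Rightarrow> tangle_term set set" where
  "braids n = braid_composites (Tangle n) 1 \<inter>
     arrows (Tangle n) (tensor_power (Tangle n) 1 n) (tensor_power (Tangle n) 1 n)"

definition blocked :: "nat \<Rightarrow> tangle_term set \<Rightarrow> tangle_term set" where
  "blocked n B = cmp (Tangle n) (Tangle_S n) (cmp (Tangle n) B (Tangle_R n))"

text \<open>Well-definedness of the product and of the inverse is \<open>BB_mult\<close> and \<open>BB_inv\<close> below.\<close>

definition BB :: "nat \<Rightarrow> tangle_term set monoid" where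
  "BB n =
    \<lparr> carrier = blocked n ` braids n,
      mult = (\<lambda>x y. THE z. \<exists>B\<in>braids n. \<exists>B'\<in>braids n.
                x = blocked n B \<and> y = blocked n B' \<and> z = blocked n (cmp (Tangle n) B B')),
      one = blocked n (ident (Tangle n) (tensor_power (Tangle n) 1 n)) \<rparr>"


section \<open>Artin's braid group\<close>

text \<open>Words in letters \<open>(i, True)\<close> for \<open>\<sigma>\<^sub>i\<close> and \<open>(i, False)\<close> for its inverse, modulo the
  smallest congruence containing free cancellation and the defining relations.\<close>

type_synonym braid_word = "(nat \<times> bool) list"

definition braid_words :: "nat \<Rightarrow> braid_word set" where
  "braid_words n = lists ({1..<n} \<times> UNIV)"

inductive artin_eq :: "nat \<Rightarrow> braid_word \<Rightarrow> braid_word \<Rightarrow> bool" for n where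
  refl: "w \<in> braid_words n \<Longrightarrow> artin_eq n w w"
| sym: "artin_eq n v w \<Longrightarrow> artin_eq n w v"
| trans: "\<lbrakk>artin_eq n u v; artin_eq n v w\<rbrakk> \<Longrightarrow> artin_eq n u w"
| cong: "\<lbrakk>artin_eq n v v'; artin_eq n w w'\<rbrakk> \<Longrightarrow> artin_eq n (v @ w) (v' @ w')"
| cancel: "\<lbrakk>1 \<le> i; i < n\<rbrakk> \<Longrightarrow> artin_eq n [(i, b), (i, \<not> b)] []"
| commute: "\<lbrakk>1 \<le> i; i + 1 < j; j < n\<rbrakk>
    \<Longrightarrow> artin_eq n [(i, True), (j, True)] [(j, True), (i, True)]"
| braid: "\<lbrakk>1 \<le> i; i + 1 < n\<rbrakk>
    \<Longrightarrow> artin_eq n [(i, True), (i + 1, True), (i, True)] [(i + 1, True), (i, True), (i + 1, True)]"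

definition artin_class :: "nat \<Rightarrow> braid_word \<Rightarrow> braid_word set" where
  "artin_class n w = {v. artin_eq n w v}"

definition Artin :: "nat \<Rightarrow> braid_word set monoid" where
  "Artin n =
    \<lparr> carrier = artin_class n ` braid_words n,
      mult = (\<lambda>x y. \<Union>v\<in>x. \<Union>w\<in>y. artin_class n (v @ w)),
      one = artin_class n [] \<rparr>"

definition artin_gen :: "nat \<Rightarrow> nat \<Rightarrow> braid_word set" where
  "artin_gen n i = artin_class n [(i, True)]"


section \<open>\<open>Tangle n\<close> is the free such category, and \<open>BB n\<close> is a group\<close>

inductive_cases tt_Id: "tangle_type n (IdT k) a b"
inductive_cases tt_Cmp: "tangle_type n (CmpT f g) a b"
inductive_cases tt_Tens: "tangle_type n (TensT f g) a b"
inductive_cases tt_Tw: "tangle_type n (TwT k l) a b"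
inductive_cases tt_TwInv: "tangle_type n (TwInvT k l) a b"
inductive_cases tt_Eta: "tangle_type n EtaT a b"
inductive_cases tt_Eps: "tangle_type n EpsT a b"
inductive_cases tt_R: "tangle_type n RT a b"
inductive_cases tt_S: "tangle_type n ST a b"

lemma tangle_type_unique:
  "\<lbrakk>tangle_type n t k l; tangle_type n t k' l'\<rbrakk> \<Longrightarrow> k = k' \<and> l = l'"
proof (induction arbitrary: k' l' rule: tangle_type.induct)
  case (2 g k l f m) then show ?case by (blast elim: tt_Cmp)
next
  case (3 f k l g k' l') then show ?case by (blast elim: tt_Tens)
qed (auto elim: tt_Id tt_Tw tt_TwInv tt_Eta tt_Eps tt_R tt_S)

lemmas ty = tangle_type.intros

lemma ty_cast: "\<lbrakk>tangle_type n t k l; k = k'; l = l'\<rbrakk> \<Longrightarrow> tangle_type n t k' l'"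
  by simp

lemma tangle_eq_type:
  "tangle_eq n f g \<Longrightarrow> \<exists>k l. tangle_type n f k l \<and> tangle_type n g k l"
proof (induction rule: tangle_eq.induct)
  case (trans f g h) then show ?case by (blast dest: tangle_type_unique)
next
  case (cmp_cong f f' g g' k l m) then show ?case by (blast intro: ty dest: tangle_type_unique)
next
  case (tens_assoc f k l g k' l' h k'' l'')
  have "tangle_type n (TensT (TensT f g) h) (k+k'+k'') (l+l'+l'')"
       "tangle_type n (TensT f (TensT g h)) (k+(k'+k'')) (l+(l'+l''))"
    using tens_assoc by (auto intro: ty)
  then show ?case by (auto simp: add.assoc)
next
  case (tens_unit f k l)
  then have "tangle_type n (TensT f (IdT 0)) (k+0) (l+0)" by (blast intro: ty)
  then show ?case using tens_unit by auto
next
  case (unit_tens f k l)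
  then have "tangle_type n (TensT (IdT 0) f) (0+k) (0+l)" by (blast intro: ty)
  then show ?case using unit_tens by auto
next
  case (tw_right k l m)
  have "tangle_type n (TwT k (l+m)) (k+l+m) (l+m+k)"
    by (rule ty_cast[OF ty(4)]) auto
  moreover have "tangle_type n (TensT (TwT k l) (IdT m)) (k+l+m) (l+k+m)" by (intro ty)
  moreover have "tangle_type n (TensT (IdT l) (TwT k m)) (l+k+m) (l+m+k)"
    by (rule ty_cast[OF ty(3)[OF ty(1) ty(4)]]) auto
  ultimately show ?case by (blast intro: ty)
next
  case (tw_left k l m)
  have "tangle_type n (TwT (k+l) m) (k+l+m) (m+k+l)"
    by (rule ty_cast[OF ty(4)]) auto
  moreover have "tangle_type n (TensT (TwT k m) (IdT l)) (k+m+l) (m+k+l)" by (intro ty)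
  moreover have "tangle_type n (TensT (IdT k) (TwT l m)) (k+l+m) (k+m+l)"
    by (rule ty_cast[OF ty(3)[OF ty(1) ty(4)]]) auto
  ultimately show ?case by (blast intro: ty)
next
  case snake1
  have "tangle_type n (TensT EpsT (IdT 1)) 3 1" "tangle_type n (TensT (IdT 1) EtaT) 1 3"
    using ty(3)[OF ty(7) ty(1), of n 1] ty(3)[OF ty(1) ty(6), of n 1] by (auto simp: numeral_3_eq_3)
  then show ?case by (blast intro: ty)
next
  case snake2
  have "tangle_type n (TensT (IdT 1) EpsT) 3 1" "tangle_type n (TensT EtaT (IdT 1)) 1 3"
    using ty(3)[OF ty(1) ty(7), of n 1] ty(3)[OF ty(6) ty(1), of n 1] by (auto simp: numeral_3_eq_3)
  then show ?case by (blast intro: ty)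
next
  case eps_tw
  have "tangle_type n (TwT 1 1) 2 2" using ty(4)[of n 1 1] by (simp add: numeral_2_eq_2)
  then show ?case by (blast intro: ty)
next
  case tw_eta
  have "tangle_type n (TwT 1 1) 2 2" using ty(4)[of n 1 1] by (simp add: numeral_2_eq_2)
  then show ?case by (blast intro: ty)
next
  case (tens_cmp f k l f' m g k' l' g' m')
  then show ?case by (meson ty(2,3))
next
  case (tw_natural f k l g k' l')
  then show ?case by (meson ty(2,3,4))
qed (meson ty)+

lemma tangle_class_eq_iff:
  "tangle_type n t k l \<Longrightarrow> tangle_class n t = tangle_class n u \<longleftrightarrow> tangle_eq n t u"
  unfolding tangle_class_def by (blast intro: tangle_eq.refl tangle_eq.sym tangle_eq.trans)

lemma tangle_class_eqI: "tangle_eq n t u \<Longrightarrow> tangle_class n t = tangle_class n u"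
  unfolding tangle_class_def by (blast intro: tangle_eq.sym tangle_eq.trans)

lemma tangle_eq_type_iff: "tangle_eq n t u \<Longrightarrow> tangle_type n t k l \<longleftrightarrow> tangle_type n u k l"
  by (metis tangle_eq_type tangle_type_unique)

lemma tangle_class_src_tgt:
  assumes "tangle_type n t k l"
  shows "src (Tangle n) (tangle_class n t) = k" "tgt (Tangle n) (tangle_class n t) = l"
proof -
  have *: "(\<exists>u\<in>tangle_class n t. tangle_type n u a b) \<longleftrightarrow> a = k \<and> b = l" for a b
    using assms tangle_eq.refl[OF assms] tangle_eq_type_iff[of n t] tangle_type_unique
    unfolding tangle_class_def by blast
  show "src (Tangle n) (tangle_class n t) = k"
    using * unfolding Tangle_def by simp (rule the_equality, blast+)
  show "tgt (Tangle n) (tangle_class n t) = l"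
    using * unfolding Tangle_def by simp (rule the_equality, blast+)
qed

lemma tangle_class_arrow:
  "tangle_type n t k l \<Longrightarrow> tangle_class n t \<in> arrows (Tangle n) k l"
  unfolding arrows_def using tangle_class_src_tgt by (fastforce simp: Tangle_def)

lemma Tangle_arrowE:
  assumes "f \<in> arrows (Tangle n) k l"
  obtains t where "f = tangle_class n t" "tangle_type n t k l"
proof -
  obtain t k' l' where "f = tangle_class n t" "tangle_type n t k' l'"
    using assms unfolding arrows_def by (auto simp: Tangle_def)
  with assms that tangle_class_src_tgt show ?thesis unfolding arrows_def by fastforce
qed

lemma Tangle_ArE:
  assumes "f \<in> Ar (Tangle n)"
  obtains t k l where "f = tangle_class n t" "tangle_type n t k l"
  using assms by (auto simp: Tangle_def)

lemma Tangle_cmp: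
  assumes "tangle_type n g k l" "tangle_type n f l m"
  shows "cmp (Tangle n) (tangle_class n f) (tangle_class n g) = tangle_class n (CmpT f g)"
proof -
  have "tangle_class n (CmpT f' g') = tangle_class n (CmpT f g)"
    if "tangle_eq n f f'" "tangle_eq n g g'" for f' g'
    using tangle_class_eqI[OF tangle_eq.cmp_cong[OF that assms]] by simp
  then have "cmp (Tangle n) (tangle_class n f) (tangle_class n g)
      = (\<Union>s\<in>tangle_class n f. \<Union>t\<in>tangle_class n g. tangle_class n (CmpT f g))"
    unfolding Tangle_def tangle_class_def[of n f] tangle_class_def[of n g] by simp
  moreover have "f \<in> tangle_class n f" "g \<in> tangle_class n g"
    using assms by (auto simp: tangle_class_def intro: tangle_eq.refl)
  ultimately show ?thesis by auto
qed

lemma Tangle_tensor: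
  assumes "tangle_type n f k l" "tangle_type n g k' l'"
  shows "tensor_ar (Tangle n) (tangle_class n f) (tangle_class n g) = tangle_class n (TensT f g)"
proof -
  have "tangle_class n (TensT f' g') = tangle_class n (TensT f g)"
    if "tangle_eq n f f'" "tangle_eq n g g'" for f' g'
    using tangle_class_eqI[OF tangle_eq.tens_cong[OF that]] by simp
  then have "tensor_ar (Tangle n) (tangle_class n f) (tangle_class n g)
      = (\<Union>s\<in>tangle_class n f. \<Union>t\<in>tangle_class n g. tangle_class n (TensT f g))"
    unfolding Tangle_def tangle_class_def[of n f] tangle_class_def[of n g] by simp
  moreover have "f \<in> tangle_class n f" "g \<in> tangle_class n g"
    using assms by (auto simp: tangle_class_def intro: tangle_eq.refl)
  ultimately show ?thesis by auto
qed

lemma Tangle_simps [simp]: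
  "Ob (Tangle n) = UNIV" "unit_ob (Tangle n) = 0" "tensor_ob (Tangle n) k l = k + l"
  "ident (Tangle n) k = tangle_class n (IdT k)" "twist (Tangle n) k l = tangle_class n (TwT k l)"
  by (simp_all add: Tangle_def)

lemma tensor_power_Tangle [simp]:
  "tensor_power (Tangle n) 1 k = k" "tensor_power (Tangle n) (Suc 0) k = k"
  by (induction k) auto

lemma Tangle_inverse_twist:
  "inverse_arrows (Tangle n) (tangle_class n (TwT k l)) (tangle_class n (TwInvT k l))"
  using tangle_class_arrow[OF ty(4), of n k l] tangle_class_arrow[OF ty(5), of n k l]
  by (simp add: inverse_arrows_def arrows_def Tangle_cmp[OF ty(4) ty(5)] Tangle_cmp[OF ty(5) ty(4)]
      tangle_class_eqI[OF tangle_eq.inv_tw] tangle_class_eqI[OF tangle_eq.tw_inv])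

lemma ty_add_assoc: "tangle_type n (IdT (k + (l + m))) (k + l + m) (k + l + m)"
  using ty(1)[of n "k+l+m"] by (simp add: add.assoc)

theorem Tangle_braided: "braided_strict_monoidal_category (Tangle n)"
proof unfold_locales
  fix f f' g g' h X Y Z W X' Y' Z'
  let ?A = "arrows (Tangle n)"
  show "f \<in> ?A X Y \<Longrightarrow> g \<in> ?A X' Y' \<Longrightarrow> tensor_ar (Tangle n) f g \<in> ?A (tensor_ob (Tangle n) X X') (tensor_ob (Tangle n) Y Y')"
    by (auto elim!: Tangle_arrowE simp: Tangle_tensor intro!: tangle_class_arrow ty)
  show "g \<in> ?A X Y \<Longrightarrow> f \<in> ?A Y Z \<Longrightarrow> cmp (Tangle n) f g \<in> ?A X Z"
    by (auto elim!: Tangle_arrowE simp: Tangle_cmp intro!: tangle_class_arrow intro: ty)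
  show "f \<in> ?A X Y \<Longrightarrow> cmp (Tangle n) f (ident (Tangle n) X) = f"
    by (elim Tangle_arrowE) (simp add: Tangle_cmp[OF ty(1)] tangle_class_eqI[OF tangle_eq.cmp_id])
  show "f \<in> ?A X Y \<Longrightarrow> cmp (Tangle n) (ident (Tangle n) Y) f = f"
    by (elim Tangle_arrowE) (simp add: Tangle_cmp[OF _ ty(1)] tangle_class_eqI[OF tangle_eq.id_cmp])
  show "h \<in> ?A W X \<Longrightarrow> g \<in> ?A X Y \<Longrightarrow> f \<in> ?A Y Z \<Longrightarrow>
       cmp (Tangle n) (cmp (Tangle n) f g) h = cmp (Tangle n) f (cmp (Tangle n) g h)"
    by (elim Tangle_arrowE) (simp add: Tangle_cmp Tangle_cmp[OF ty(2)] Tangle_cmp[OF _ ty(2)]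
         tangle_class_eqI[OF tangle_eq.cmp_assoc])
  show "f \<in> ?A X Y \<Longrightarrow> f' \<in> ?A Y Z \<Longrightarrow> g \<in> ?A X' Y' \<Longrightarrow> g' \<in> ?A Y' Z' \<Longrightarrow>
       tensor_ar (Tangle n) (cmp (Tangle n) f' f) (cmp (Tangle n) g' g) =
       cmp (Tangle n) (tensor_ar (Tangle n) f' g') (tensor_ar (Tangle n) f g)"
    by (elim Tangle_arrowE)
       (simp add: Tangle_cmp Tangle_tensor[OF ty(2) ty(2)] Tangle_tensor Tangle_cmp[OF ty(3) ty(3)]
         tangle_class_eqI[OF tangle_eq.tens_cmp])
  show "f \<in> Ar (Tangle n) \<Longrightarrow> g \<in> Ar (Tangle n) \<Longrightarrow> h \<in> Ar (Tangle n) \<Longrightarrow>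
       tensor_ar (Tangle n) (tensor_ar (Tangle n) f g) h = tensor_ar (Tangle n) f (tensor_ar (Tangle n) g h)"
    by (elim Tangle_ArE)
       (simp add: Tangle_tensor Tangle_tensor[OF ty(3)] Tangle_tensor[OF _ ty(3)]
         tangle_class_eqI[OF tangle_eq.tens_assoc])
  show "f \<in> Ar (Tangle n) \<Longrightarrow> tensor_ar (Tangle n) f (ident (Tangle n) (unit_ob (Tangle n))) = f"
    by (elim Tangle_ArE) (simp add: Tangle_tensor[OF _ ty(1)] tangle_class_eqI[OF tangle_eq.tens_unit])
  show "f \<in> Ar (Tangle n) \<Longrightarrow> tensor_ar (Tangle n) (ident (Tangle n) (unit_ob (Tangle n))) f = f"
    by (elim Tangle_ArE) (simp add: Tangle_tensor[OF ty(1)] tangle_class_eqI[OF tangle_eq.unit_tens])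
  show "\<exists>g. inverse_arrows (Tangle n) (twist (Tangle n) X Y) g"
    using Tangle_inverse_twist by auto
  show "f \<in> ?A X X' \<Longrightarrow> g \<in> ?A Y Y' \<Longrightarrow>
       cmp (Tangle n) (twist (Tangle n) X' Y') (tensor_ar (Tangle n) f g) =
       cmp (Tangle n) (tensor_ar (Tangle n) g f) (twist (Tangle n) X Y)"
    by (elim Tangle_arrowE)
      (simp add: Tangle_tensor Tangle_cmp[OF ty(3) ty(4)] Tangle_cmp[OF ty(4) ty(3)]
        tangle_class_eqI[OF tangle_eq.tw_natural])
  have "tangle_type n (TensT (IdT Y) (TwT X Z)) (Y+X+Z) (Y+(Z+X))"
    by (rule ty_cast[OF ty(3)[OF ty(1) ty(4)]]) auto
  then show "twist (Tangle n) X (tensor_ob (Tangle n) Y Z) =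
      cmp (Tangle n) (tensor_ar (Tangle n) (ident (Tangle n) Y) (twist (Tangle n) X Z))
         (tensor_ar (Tangle n) (twist (Tangle n) X Y) (ident (Tangle n) Z))"
    by (simp add: Tangle_tensor[OF ty(1) ty(4)] Tangle_tensor[OF ty(4) ty(1)]
       Tangle_cmp[OF ty(3)[OF ty(4) ty(1)]] tangle_class_eqI[OF tangle_eq.tw_right])
  have "tangle_type n (TensT (IdT X) (TwT Y Z)) (X+(Y+Z)) (X+Z+Y)"
    by (rule ty_cast[OF ty(3)[OF ty(1) ty(4)]]) auto
  then show "twist (Tangle n) (tensor_ob (Tangle n) X Y) Z =
      cmp (Tangle n) (tensor_ar (Tangle n) (twist (Tangle n) X Z) (ident (Tangle n) Y))
         (tensor_ar (Tangle n) (ident (Tangle n) X) (twist (Tangle n) Y Z))"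
    by (simp add: Tangle_tensor[OF ty(1) ty(4)] Tangle_tensor[OF ty(4) ty(1)]
       Tangle_cmp[OF _ ty(3)[OF ty(4) ty(1)]] tangle_class_eqI[OF tangle_eq.tw_left])
qed (simp_all add: Tangle_tensor[OF ty(1) ty(1)] tangle_class_eqI[OF tangle_eq.tens_id]
   tangle_class_arrow ty)

theorem Tangle_tangle_algebra:
  "tangle_algebra (Tangle n) 1 (tangle_class n EtaT) (tangle_class n EpsT)"
proof -
  have e: "tangle_type n (TensT EpsT (IdT 1)) 3 1" "tangle_type n (TensT (IdT 1) EtaT) 1 3"
      "tangle_type n (TensT (IdT 1) EpsT) 3 1" "tangle_type n (TensT EtaT (IdT 1)) 1 3"
    using ty(3)[OF ty(7) ty(1), of n 1] ty(3)[OF ty(1) ty(6), of n 1] 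
     ty(3)[OF ty(1) ty(7), of n 1] ty(3)[OF ty(6) ty(1), of n 1] by (auto simp: numeral_3_eq_3)
  have t: "tangle_type n (TwT 1 1) 2 2" using ty(4)[of n 1 1] by (simp add: numeral_2_eq_2)
  have "tensor_ar (Tangle n) (tangle_class n EpsT) (tangle_class n (IdT 1)) = tangle_class n (TensT EpsT (IdT 1))"
   "tensor_ar (Tangle n) (tangle_class n (IdT 1)) (tangle_class n EpsT) = tangle_class n (TensT (IdT 1) EpsT)"
   "tensor_ar (Tangle n) (tangle_class n EtaT) (tangle_class n (IdT 1)) = tangle_class n (TensT EtaT (IdT 1))"
   "tensor_ar (Tangle n) (tangle_class n (IdT 1)) (tangle_class n EtaT) = tangle_class n (TensT (IdT 1) EtaT)"
    by (rule Tangle_tensor; rule ty)+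
  then show ?thesis
    using Tangle_cmp[OF e(2) e(1)] Tangle_cmp[OF e(4) e(3)] Tangle_cmp[OF t ty(7)] Tangle_cmp[OF ty(6) t]
      tangle_class_arrow[OF ty(6), of n] tangle_class_arrow[OF ty(7), of n]
      tangle_class_eqI[OF tangle_eq.snake1, of n] tangle_class_eqI[OF tangle_eq.snake2, of n] 
      tangle_class_eqI[OF tangle_eq.eps_tw, of n] tangle_class_eqI[OF tangle_eq.tw_eta, of n]
    by (simp add: tangle_algebra_def numeral_2_eq_2)
qed


text \<open>The universal property of \<open>Tangle n\<close>.\<close>

locale strict_braided_functor =
  fixes C :: "('o, 'a, 'm) braided_data_scheme" and D :: "('p, 'b, 'n) braided_data_scheme"
    and Fo :: "'o \<Rightarrow> 'p" and Fa :: "'a \<Rightarrow> 'b"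
  assumes functor_ob: "X \<in> Ob C \<Longrightarrow> Fo X \<in> Ob D"
    and functor_ar: "f \<in> arrows C X Y \<Longrightarrow> Fa f \<in> arrows D (Fo X) (Fo Y)"
    and functor_ident: "X \<in> Ob C \<Longrightarrow> Fa (ident C X) = ident D (Fo X)"
    and functor_cmp: "\<lbrakk>g \<in> arrows C X Y; f \<in> arrows C Y Z\<rbrakk> \<Longrightarrow> Fa (cmp C f g) = cmp D (Fa f) (Fa g)"
    and functor_unit: "Fo (unit_ob C) = unit_ob D"
    and functor_tensor_ob: "\<lbrakk>X \<in> Ob C; Y \<in> Ob C\<rbrakk> \<Longrightarrow> Fo (tensor_ob C X Y) = tensor_ob D (Fo X) (Fo Y)"
    and functor_tensor_ar: "\<lbrakk>f \<in> Ar C; g \<in> Ar C\<rbrakk> \<Longrightarrow> Fa (tensor_ar C f g) = tensor_ar D (Fa f) (Fa g)"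
    and functor_twist: "\<lbrakk>X \<in> Ob C; Y \<in> Ob C\<rbrakk> \<Longrightarrow> Fa (twist C X Y) = twist D (Fo X) (Fo Y)"

lemma (in strict_monoidal_category) tensor_power_closed:
  "A \<in> Ob C \<Longrightarrow> tensor_power C A k \<in> Ob C"
  by (induction k) (auto intro: unit_closed tensor_ob_closed)

lemma (in strict_monoidal_category) tensor_power_add:
  "A \<in> Ob C \<Longrightarrow> tensor_power C A (k + l) = tensor_power C A k \<odot> tensor_power C A l"
  by (induction l) (auto simp: tensor_ob_unit tensor_ob_assoc tensor_power_closed)

lemma (in category) inverse_arrows_unique:
  assumes "inverse_arrows C f g" "inverse_arrows C f h"
  shows "g = h"
proof -
  let ?X = "src C f" and ?Y = "tgt C f"
  have f: "f \<in> arrows C ?X ?Y" and g: "g \<in> arrows C ?Y ?X" and h: "h \<in> arrows C ?Y ?X"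
    and gf: "g \<cdot> f = ident C ?X" and fh: "f \<cdot> h = ident C ?Y"
    using assms by (auto simp: inverse_arrows_def arrows_def)
  have "g = g \<cdot> (f \<cdot> h)" using cmp_ident[OF g] fh by simp
  also have "\<dots> = (g \<cdot> f) \<cdot> h" using cmp_assoc[OF h f g] by simp
  also have "\<dots> = h" using ident_cmp[OF h] gf by simp
  finally show ?thesis .
qed

lemma (in category) inv_arrow_eq: "inverse_arrows C f g \<Longrightarrow> inv_arrow C f = g"
  unfolding inv_arrow_def by (blast intro: inverse_arrows_unique)

lemma (in braided_strict_monoidal_category) inv_twist:
  assumes "X \<in> Ob C" "Y \<in> Ob C"
  shows "inv_arrow C (twist C X Y) \<in> arrows C (Y \<odot> X) (X \<odot> Y)"
    "inv_arrow C (twist C X Y) \<cdot> twist C X Y = ident C (X \<odot> Y)"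
    "twist C X Y \<cdot> inv_arrow C (twist C X Y) = ident C (Y \<odot> X)"
proof -
  obtain g where g: "inverse_arrows C (twist C X Y) g" using twist_iso assms by blast
  show "inv_arrow C (twist C X Y) \<in> arrows C (Y \<odot> X) (X \<odot> Y)"
    "inv_arrow C (twist C X Y) \<cdot> twist C X Y = ident C (X \<odot> Y)"
    "twist C X Y \<cdot> inv_arrow C (twist C X Y) = ident C (Y \<odot> X)"
    using g twist_closed[OF assms] unfolding inv_arrow_eq[OF g] inverse_arrows_def
    by (auto simp: arrows_def)
qed

primrec interp :: "('o, 'a, 'm) braided_data_scheme \<Rightarrow> 'o \<Rightarrow> 'a \<Rightarrow> 'a \<Rightarrow> 'a \<Rightarrow> 'a \<Rightarrow> tangle_term \<Rightarrow> 'a" where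
  "interp C A \<eta> \<epsilon> r s (IdT k) = ident C (tensor_power C A k)"
| "interp C A \<eta> \<epsilon> r s (CmpT f g) = cmp C (interp C A \<eta> \<epsilon> r s f) (interp C A \<eta> \<epsilon> r s g)"
| "interp C A \<eta> \<epsilon> r s (TensT f g) = tensor_ar C (interp C A \<eta> \<epsilon> r s f) (interp C A \<eta> \<epsilon> r s g)"
| "interp C A \<eta> \<epsilon> r s (TwT k l) = twist C (tensor_power C A k) (tensor_power C A l)"
| "interp C A \<eta> \<epsilon> r s (TwInvT k l) = inv_arrow C (twist C (tensor_power C A k) (tensor_power C A l))"
| "interp C A \<eta> \<epsilon> r s EtaT = \<eta>"
| "interp C A \<eta> \<epsilon> r s EpsT = \<epsilon>"
| "interp C A \<eta> \<epsilon> r s RT = r"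
| "interp C A \<eta> \<epsilon> r s ST = s"

locale tangle_model = braided_strict_monoidal_category +
  fixes A \<eta> \<epsilon> r s and n :: nat
  assumes tangle_algebra: "tangle_algebra C A \<eta> \<epsilon>"
    and r: "r \<in> arrows C (unit_ob C) (tensor_power C A n)"
    and s: "s \<in> arrows C (tensor_power C A n) (unit_ob C)"
begin

lemma A_closed [simp]: "A \<in> Ob C"
  using tangle_algebra by (simp add: tangle_algebra_def)

lemmas tp_closed = tensor_power_closed[OF A_closed]
lemmas tp_add = tensor_power_add[OF A_closed]

lemma tp_1 [simp]: "tensor_power C A 1 = A" "tensor_power C A (Suc 0) = A"
  by (simp_all add: unit_tensor_ob)

lemma tp_2: "tensor_power C A 2 = A \<odot> A"
  by (simp add: numeral_2_eq_2 unit_tensor_ob)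

abbreviation ev where "ev \<equiv> interp C A \<eta> \<epsilon> r s"
abbreviation tp where "tp \<equiv> tensor_power C A"

lemma interp_type: "tangle_type n t k l \<Longrightarrow> ev t \<in> arrows C (tp k) (tp l)"
proof (induction rule: tangle_type.induct)
  case 6 then show ?case using tangle_algebra by (simp add: tangle_algebra_def tp_2)
next
  case 7 then show ?case using tangle_algebra by (simp add: tangle_algebra_def tp_2)
qed (auto simp: ident_closed tp_closed tp_add inv_twist twist_closed tensor_ar_closed r s intro: cmp_closed)

lemma arr: "f \<in> arrows C X Y \<Longrightarrow> f \<in> Ar C"
  by (simp add: arrows_def)

lemma interp_eq: "tangle_eq n t u \<Longrightarrow> ev t = ev u"
proof (induction rule: tangle_eq.induct)
  case (tens_cmp f k l f' m g k' l' g' m')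
  then show ?case by (simp add: tensor_cmp[OF interp_type interp_type interp_type interp_type])
next
  case (tw_natural f k l g k' l')
  then show ?case by (simp add: twist_natural[OF interp_type interp_type])
next
  case prems: (cmp_assoc h k l g m f p)
  then show ?case by (simp add: cmp_assoc[OF interp_type interp_type interp_type])
next
  case (tens_assoc f k l g k' l' h k'' l'')
  then show ?case by (simp add: tensor_ar_assoc[OF interp_type[THEN arr] interp_type[THEN arr] interp_type[THEN arr]])
next
  case (tens_unit f k l)
  then show ?case by (simp add: tensor_ar_unit[OF interp_type[THEN arr]])
next
  case (unit_tens f k l)
  then show ?case by (simp add: unit_tensor_ar[OF interp_type[THEN arr]])
next
  case (cmp_id f k l) then show ?case by (simp add: cmp_ident[OF interp_type])
next
  case (id_cmp f k l) then show ?case by (simp add: ident_cmp[OF interp_type])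
next
  case snake1 then show ?case using tangle_algebra
    by (simp add: tangle_algebra_def unit_tensor_ob)
next
  case snake2 then show ?case using tangle_algebra
    by (simp add: tangle_algebra_def unit_tensor_ob)
next
  case eps_tw then show ?case using tangle_algebra
    by (simp add: tangle_algebra_def unit_tensor_ob)
next
  case tw_eta then show ?case using tangle_algebra
    by (simp add: tangle_algebra_def unit_tensor_ob)
qed (simp_all add: tensor_ident tp_closed tp_add inv_twist twist_tensor_right twist_tensor_left)

definition interp_class :: "tangle_term set \<Rightarrow> 'b" where
  "interp_class f = the_elem (ev ` f)"

lemma interp_class: "tangle_type n t k l \<Longrightarrow> interp_class (tangle_class n t) = ev t"
proof -
  assume "tangle_type n t k l"
  then have "t \<in> tangle_class n t" by (simp add: tangle_class_def tangle_eq.refl)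
  moreover have "ev u = ev t" if "u \<in> tangle_class n t" for u
    using that interp_eq by (simp add: tangle_class_def)
  ultimately have "ev ` tangle_class n t = {ev t}" by blast
  then show ?thesis by (simp add: interp_class_def)
qed

lemma interp_functor: "strict_braided_functor (Tangle n) C tp interp_class"
proof
  fix X Y Z f g
  show "f \<in> arrows (Tangle n) X Y \<Longrightarrow> interp_class f \<in> arrows C (tp X) (tp Y)"
    by (auto elim!: Tangle_arrowE simp: interp_class interp_type)
  show "g \<in> arrows (Tangle n) X Y \<Longrightarrow> f \<in> arrows (Tangle n) Y Z \<Longrightarrow>
       interp_class (cmp (Tangle n) f g) = interp_class f \<cdot> interp_class g"
    by (elim Tangle_arrowE) (simp add: Tangle_cmp interp_class interp_class[OF ty(2)])
  show "f \<in> Ar (Tangle n) \<Longrightarrow> g \<in> Ar (Tangle n) \<Longrightarrow>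
       interp_class (tensor_ar (Tangle n) f g) = interp_class f \<star> interp_class g"
    by (elim Tangle_ArE) (simp add: Tangle_tensor interp_class interp_class[OF ty(3)])
qed (simp_all add: tp_closed tp_add interp_class[OF ty(1)] interp_class[OF ty(4)])

lemma functor_unique:
  assumes "strict_braided_functor (Tangle n) C Fo Fa"
    and "Fo 1 = A" "Fa (tangle_class n EtaT) = \<eta>" "Fa (tangle_class n EpsT) = \<epsilon>"
      "Fa (Tangle_R n) = r" "Fa (Tangle_S n) = s"
  shows "Fo k = tp k" and "f \<in> Ar (Tangle n) \<Longrightarrow> Fa f = interp_class f"
proof -
  interpret F: strict_braided_functor "Tangle n" C Fo Fa by fact
  have Fo: "Fo k = tp k" for k
  proof (induction k)
    case 0 then show ?case using F.functor_unit by simp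
  next
    case (Suc k) then show ?case using F.functor_tensor_ob[of k 1] assms(2) by simp
  qed
  then show "Fo k = tp k" .
  have Fa: "tangle_type n t k l \<Longrightarrow> Fa (tangle_class n t) = ev t" for t k l
  proof (induction rule: tangle_type.induct)
    case (1 k) then show ?case using F.functor_ident[of k] Fo by simp
  next
    case (2 g k l f m)
    then show ?case using F.functor_cmp[OF tangle_class_arrow tangle_class_arrow] by (simp add: Tangle_cmp)
  next
    case (3 f k l g k' l')
    then have "tangle_class n f \<in> Ar (Tangle n)" "tangle_class n g \<in> Ar (Tangle n)"
      using tangle_class_arrow by (auto simp: arrows_def)
    then show ?case using F.functor_tensor_ar 3 by (simp add: Tangle_tensor[symmetric])
  next
    case (4 k l) then show ?case using F.functor_twist[of k l] Fo by simp
  next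
    case (5 k l)
    let ?f = "tangle_class n (TwT k l)" and ?g = "tangle_class n (TwInvT k l)"
    have fg: "?f \<in> arrows (Tangle n) (k+l) (l+k)" "?g \<in> arrows (Tangle n) (l+k) (k+l)"
      by (simp_all add: tangle_class_arrow ty)
    have i: "cmp (Tangle n) ?g ?f = ident (Tangle n) (k+l)" "cmp (Tangle n) ?f ?g = ident (Tangle n) (l+k)"
      using Tangle_inverse_twist[of n k l] fg by (auto simp: inverse_arrows_def arrows_def)
    have "inverse_arrows C (Fa ?f) (Fa ?g)"
      using F.functor_ar[OF fg(1)] F.functor_ar[OF fg(2)]
        F.functor_cmp[OF fg] F.functor_cmp[OF fg(2) fg(1)] i F.functor_ident[of "k+l"] F.functor_ident[of "l+k"]
      by (simp add: inverse_arrows_def arrows_def)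
    moreover have "Fa ?f = twist C (tp k) (tp l)" using F.functor_twist[of k l] Fo by simp
    ultimately show ?case using inv_arrow_eq by simp
  qed (use assms in \<open>simp_all add: Tangle_R_def Tangle_S_def\<close>)
  show "f \<in> Ar (Tangle n) \<Longrightarrow> Fa f = interp_class f"
    by (elim Tangle_ArE) (simp add: Fa interp_class)
qed

end

theorem tangle_free:
  assumes "braided_strict_monoidal_category C" "tangle_algebra C A \<eta> \<epsilon>"
    and "r \<in> arrows C (unit_ob C) (tensor_power C A n)"
    and "s \<in> arrows C (tensor_power C A n) (unit_ob C)"
  shows "\<exists>Fo Fa.
    (strict_braided_functor (Tangle n) C Fo Fa \<and> Fo 1 = A \<and>
     Fa (tangle_class n EtaT) = \<eta> \<and> Fa (tangle_class n EpsT) = \<epsilon> \<and>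
     Fa (Tangle_R n) = r \<and> Fa (Tangle_S n) = s) \<and>
    (\<forall>Go Ga.
       strict_braided_functor (Tangle n) C Go Ga \<and> Go 1 = A \<and>
       Ga (tangle_class n EtaT) = \<eta> \<and> Ga (tangle_class n EpsT) = \<epsilon> \<and>
       Ga (Tangle_R n) = r \<and> Ga (Tangle_S n) = s \<longrightarrow>
       Go = Fo \<and> (\<forall>f\<in>Ar (Tangle n). Ga f = Fa f))"
proof -
  interpret tangle_model C A \<eta> \<epsilon> r s n
    using assms by (simp add: tangle_model_def tangle_model_axioms_def)
  have "strict_braided_functor (Tangle n) C tp interp_class \<and> tp 1 = A \<and>
     interp_class (tangle_class n EtaT) = \<eta> \<and> interp_class (tangle_class n EpsT) = \<epsilon> \<and>
     interp_class (Tangle_R n) = r \<and> interp_class (Tangle_S n) = s"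
    by (simp add: interp_functor Tangle_R_def Tangle_S_def interp_class[OF ty(6)]
        interp_class[OF ty(7)] interp_class[OF ty(8)] interp_class[OF ty(9)] unit_tensor_ob)
  moreover have "Go = tp \<and> (\<forall>f\<in>Ar (Tangle n). Ga f = interp_class f)"
    if "strict_braided_functor (Tangle n) C Go Ga \<and> Go 1 = A \<and>
       Ga (tangle_class n EtaT) = \<eta> \<and> Ga (tangle_class n EpsT) = \<epsilon> \<and>
       Ga (Tangle_R n) = r \<and> Ga (Tangle_S n) = s" for Go Ga
    using that functor_unique[of Go Ga] by (intro conjI ext ballI) metis+
  ultimately show ?thesis by blast
qed

text \<open>Since \<open>R\<close> and \<open>S\<close> satisfy no equations, they may be replaced by \<open>C R\<close> and \<open>S D\<close> for
  braids \<open>C\<close> and \<open>D\<close>; this makes the operations of \<open>BB n\<close> well defined.\<close>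

abbreviation tcmp :: "tangle_term set \<Rightarrow> nat \<Rightarrow> tangle_term set \<Rightarrow> tangle_term set" where
  "tcmp f n g \<equiv> cmp (Tangle n) f g"

lemma Tangle_R_S_arrow:
  "Tangle_R n \<in> arrows (Tangle n) 0 n" "Tangle_S n \<in> arrows (Tangle n) n 0"
  by (simp_all add: Tangle_R_def Tangle_S_def tangle_class_arrow ty)

lemma Tangle_inv_twist: "inv_arrow (Tangle n) (tangle_class n (TwT k l)) = tangle_class n (TwInvT k l)"
proof -
  interpret T: braided_strict_monoidal_category "Tangle n" by (rule Tangle_braided)
  show ?thesis using Tangle_inverse_twist T.inv_arrow_eq by blast
qed

lemma braid_layer_arrow: "f \<in> braid_layers (Tangle n) 1 \<Longrightarrow> \<exists>k. f \<in> arrows (Tangle n) k k"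
proof (induction rule: braid_layers.induct)
  case (1 k) then show ?case by (auto intro: tangle_class_arrow ty)
next
  case 2 then show ?case by (auto intro!: tangle_class_arrow[OF ty(4)])
next
  case 3 then show ?case
    using tangle_class_arrow[OF ty(5)[of n 1 1]] by (auto simp: Tangle_inv_twist)
next
  case (4 f g) then show ?case
    by (elim exE Tangle_arrowE) (auto simp: Tangle_tensor intro: tangle_class_arrow ty)
qed

lemma braid_composite_arrow: "f \<in> braid_composites (Tangle n) 1 \<Longrightarrow> \<exists>k. f \<in> arrows (Tangle n) k k"
proof (induction rule: braid_composites.induct)
  case (1 f) then show ?case using braid_layer_arrow by blast
next
  case (2 f g)
  interpret T: braided_strict_monoidal_category "Tangle n" by (rule Tangle_braided)
  from 2 show ?case using T.cmp_closed by (fastforce simp: arrows_def)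
qed

lemma inverse_arrows_sym: "inverse_arrows C f g \<Longrightarrow> inverse_arrows C g f"
  by (auto simp: inverse_arrows_def arrows_def)

lemma inverse_arrowsI:
  "\<lbrakk>f \<in> arrows C X Y; g \<in> arrows C Y X; cmp C g f = ident C X; cmp C f g = ident C Y\<rbrakk>
   \<Longrightarrow> inverse_arrows C f g"
  by (auto simp: inverse_arrows_def arrows_def)

lemma inverse_arrowsD:
  assumes "inverse_arrows C f g" "f \<in> arrows C X Y"
  shows "g \<in> arrows C Y X" "cmp C g f = ident C X" "cmp C f g = ident C Y"
  using assms by (auto simp: inverse_arrows_def arrows_def)

lemma braid_layer_inverse:
  "f \<in> braid_layers (Tangle n) 1 \<Longrightarrow> \<exists>g\<in>braid_layers (Tangle n) 1. inverse_arrows (Tangle n) f g"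
proof (induction rule: braid_layers.induct)
  case (1 k)
  interpret T: braided_strict_monoidal_category "Tangle n" by (rule Tangle_braided)
  let ?i = "ident (Tangle n) (tensor_power (Tangle n) 1 k)"
  have "?i \<in> arrows (Tangle n) k k" using T.ident_closed[of k] by simp
  then have "inverse_arrows (Tangle n) ?i ?i"
    using T.cmp_ident[of _ k k] by (auto intro!: inverse_arrowsI simp del: Tangle_simps(4))
  then show ?case by (rule bexI[where x = ?i]) (rule braid_layers.intros(1))
next
  case 2 then show ?case
    using Tangle_inverse_twist[of n 1 1] braid_layers.intros(3)[of "Tangle n" 1] by (auto simp: Tangle_inv_twist)
next
  case 3 then show ?case
    using Tangle_inverse_twist[of n 1 1, THEN inverse_arrows_sym] braid_layers.intros(2)[of "Tangle n" 1]
    by (auto simp: Tangle_inv_twist)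
next
  case (4 f g)
  interpret T: braided_strict_monoidal_category "Tangle n" by (rule Tangle_braided)
  obtain f' g' where fg': "f' \<in> braid_layers (Tangle n) 1" "inverse_arrows (Tangle n) f f'"
      "g' \<in> braid_layers (Tangle n) 1" "inverse_arrows (Tangle n) g g'"
    using "4.IH" by (elim bexE) (rule that)
  obtain k l where fg: "f \<in> arrows (Tangle n) k k" "g \<in> arrows (Tangle n) l l"
    using braid_layer_arrow[OF "4.hyps"(1)] braid_layer_arrow[OF "4.hyps"(2)] by (elim exE) (rule that)
  note f' = inverse_arrowsD[OF fg'(2) fg(1)] and g' = inverse_arrowsD[OF fg'(4) fg(2)]
  have "tensor_ar (Tangle n) f g \<in> arrows (Tangle n) (tensor_ob (Tangle n) k l) (tensor_ob (Tangle n) k l)"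
    by (rule T.tensor_ar_closed[OF fg])
  moreover have "tensor_ar (Tangle n) f' g' \<in> arrows (Tangle n) (tensor_ob (Tangle n) k l) (tensor_ob (Tangle n) k l)"
    by (rule T.tensor_ar_closed[OF f'(1) g'(1)])
  moreover have "cmp (Tangle n) (tensor_ar (Tangle n) f' g') (tensor_ar (Tangle n) f g)
      = ident (Tangle n) (tensor_ob (Tangle n) k l)"
    unfolding T.tensor_cmp[OF fg(1) f'(1) fg(2) g'(1), symmetric] f'(2) g'(2)
    by (rule T.tensor_ident) simp_all
  moreover have "cmp (Tangle n) (tensor_ar (Tangle n) f g) (tensor_ar (Tangle n) f' g')
      = ident (Tangle n) (tensor_ob (Tangle n) k l)"
    unfolding T.tensor_cmp[OF f'(1) fg(1) g'(1) fg(2), symmetric] f'(3) g'(3)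
    by (rule T.tensor_ident) simp_all
  ultimately have "inverse_arrows (Tangle n) (tensor_ar (Tangle n) f g) (tensor_ar (Tangle n) f' g')"
    by (rule inverse_arrowsI)
  then show ?case
    by (rule bexI[where x = "tensor_ar (Tangle n) f' g'"]) (intro braid_layers.intros(4) fg')
qed

lemma braid_composite_inverse:
  "f \<in> braid_composites (Tangle n) 1 \<Longrightarrow> \<exists>g\<in>braid_composites (Tangle n) 1. inverse_arrows (Tangle n) f g"
proof (induction rule: braid_composites.induct)
  case (1 f) then show ?case using braid_layer_inverse braid_composites.intros(1) by meson
next
  case (2 f g)
  interpret T: braided_strict_monoidal_category "Tangle n" by (rule Tangle_braided)
  obtain f' g' where fg': "f' \<in> braid_composites (Tangle n) 1" "inverse_arrows (Tangle n) f f'"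
      "g' \<in> braid_composites (Tangle n) 1" "inverse_arrows (Tangle n) g g'"
    using 2 by blast
  obtain k l where kl: "f \<in> arrows (Tangle n) k k" "g \<in> arrows (Tangle n) l l"
    using 2 braid_composite_arrow by meson
  then have "l = k" using 2 by (auto simp: arrows_def)
  with kl have fg: "f \<in> arrows (Tangle n) k k" "g \<in> arrows (Tangle n) k k" by auto
  note f' = inverse_arrowsD[OF fg'(2) fg(1)] and g' = inverse_arrowsD[OF fg'(4) fg(2)]
  have c: "tcmp f n g \<in> arrows (Tangle n) k k" "tcmp g' n f' \<in> arrows (Tangle n) k k"
    using T.cmp_closed fg f'(1) g'(1) by blast+
  have "tcmp (tcmp g' n f') n (tcmp f n g) = tcmp g' n (tcmp f' n (tcmp f n g))"
    by (rule T.cmp_assoc[OF c(1) f'(1) g'(1)])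
  also have "\<dots> = tcmp g' n (tcmp (tcmp f' n f) n g)" using T.cmp_assoc[OF fg(2) fg(1) f'(1)] by simp
  also have "\<dots> = ident (Tangle n) k" unfolding f'(2) T.ident_cmp[OF fg(2)] g'(2) ..
  finally have 1: "tcmp (tcmp g' n f') n (tcmp f n g) = ident (Tangle n) k" .
  have "tcmp (tcmp f n g) n (tcmp g' n f') = tcmp f n (tcmp g n (tcmp g' n f'))"
    by (rule T.cmp_assoc[OF c(2) fg(2) fg(1)])
  also have "\<dots> = tcmp f n (tcmp (tcmp g n g') n f')" using T.cmp_assoc[OF f'(1) g'(1) fg(2)] by simp
  also have "\<dots> = ident (Tangle n) k" unfolding g'(3) T.ident_cmp[OF f'(1)] f'(3) ..
  finally have "inverse_arrows (Tangle n) (tcmp f n g) (tcmp g' n f')"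
    using inverse_arrowsI[OF c 1] by blast
  moreover have "tcmp g' n f' \<in> braid_composites (Tangle n) 1"
    using fg' f'(1) g'(1) by (intro braid_composites.intros(2)) (simp_all add: arrows_def)
  ultimately show ?case by blast
qed

lemma braids_arrow: "B \<in> braids n \<Longrightarrow> B \<in> arrows (Tangle n) n n"
  by (simp add: braids_def)

lemma braids_ident: "ident (Tangle n) n \<in> braids n"
  using braid_layers.intros(1)[of "Tangle n" 1 n]
  by (auto simp: braids_def intro: braid_composites.intros tangle_class_arrow ty)

lemma braids_cmp: "\<lbrakk>B \<in> braids n; B' \<in> braids n\<rbrakk> \<Longrightarrow> tcmp B n B' \<in> braids n"
proof -
  interpret T: braided_strict_monoidal_category "Tangle n" by (rule Tangle_braided)
  show "\<lbrakk>B \<in> braids n; B' \<in> braids n\<rbrakk> \<Longrightarrow> tcmp B n B' \<in> braids n"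
    using T.cmp_closed[of B' n n B n]
    by (auto simp: braids_def arrows_def intro: braid_composites.intros)
qed

lemma braids_inv:
  assumes "B \<in> braids n"
  shows "inv_arrow (Tangle n) B \<in> braids n"
    "tcmp (inv_arrow (Tangle n) B) n B = ident (Tangle n) n"
    "tcmp B n (inv_arrow (Tangle n) B) = ident (Tangle n) n"
proof -
  interpret T: braided_strict_monoidal_category "Tangle n" by (rule Tangle_braided)
  have "B \<in> braid_composites (Tangle n) 1" using assms by (simp add: braids_def)
  then obtain g where g: "g \<in> braid_composites (Tangle n) 1" "inverse_arrows (Tangle n) B g"
    using braid_composite_inverse by blast
  note * = inverse_arrowsD[OF g(2) braids_arrow[OF assms]]
  show "inv_arrow (Tangle n) B \<in> braids n"
    "tcmp (inv_arrow (Tangle n) B) n B = ident (Tangle n) n"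
    "tcmp B n (inv_arrow (Tangle n) B) = ident (Tangle n) n"
    unfolding T.inv_arrow_eq[OF g(2)] using g * by (auto simp: braids_def)
qed

lemma blocked_cong:
  assumes B: "B \<in> braids n" "B' \<in> braids n" and c: "c \<in> braids n" "d \<in> braids n"
    and eq: "blocked n B = blocked n B'"
  shows "blocked n (tcmp d n (tcmp B n c)) = blocked n (tcmp d n (tcmp B' n c))"
proof -
  interpret T: braided_strict_monoidal_category "Tangle n" by (rule Tangle_braided)
  note RS = Tangle_R_S_arrow[of n] and ca = braids_arrow[OF c(1)] braids_arrow[OF c(2)]
  interpret M: tangle_model "Tangle n" 1 "tangle_class n EtaT" "tangle_class n EpsT"
    "tcmp c n (Tangle_R n)" "tcmp (Tangle_S n) n d" n
    by unfold_locales (use Tangle_tangle_algebra T.cmp_closed[OF RS(1) ca(1)] T.cmp_closed[OF ca(2) RS(2)] in simp_all)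
  interpret F: strict_braided_functor "Tangle n" "Tangle n" "tensor_power (Tangle n) 1" M.interp_class
    by (rule M.interp_functor)
  have layer: "M.interp_class f = f" if "f \<in> braid_layers (Tangle n) 1" for f
    using that
  proof (induction rule: braid_layers.induct)
    case (4 f g)
    then have "f \<in> Ar (Tangle n)" "g \<in> Ar (Tangle n)"
      using braid_layer_arrow by (fastforce simp: arrows_def)+
    then show ?case using 4 F.functor_tensor_ar by simp
  qed (simp_all add: M.interp_class[OF ty(1)] M.interp_class[OF ty(4)] M.interp_class[OF ty(5)] Tangle_inv_twist
      del: One_nat_def)
  have comp: "M.interp_class f = f" if "f \<in> braid_composites (Tangle n) 1" for f
    using that
  proof (induction rule: braid_composites.induct)
    case (2 f g)
    then obtain k l where "f \<in> arrows (Tangle n) k k" "g \<in> arrows (Tangle n) l l"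
      using braid_composite_arrow by meson
    with 2 show ?case using F.functor_cmp[of g l l f] by (auto simp: arrows_def)
  qed (rule layer)
  have "M.interp_class (blocked n b) = blocked n (tcmp d n (tcmp b n c))" if b: "b \<in> braids n" for b
  proof -
    note ba = braids_arrow[OF b]
    have "M.interp_class (blocked n b)
        = tcmp (tcmp (Tangle_S n) n d) n (tcmp b n (tcmp c n (Tangle_R n)))"
      unfolding blocked_def
      using F.functor_cmp[OF T.cmp_closed[OF RS(1) ba] RS(2)] F.functor_cmp[OF RS(1) ba]
        comp[of b] b
        M.interp_class[OF ty(8), folded Tangle_R_def] M.interp_class[OF ty(9), folded Tangle_S_def]
      by (simp add: braids_def del: One_nat_def)
    also have "\<dots> = blocked n (tcmp d n (tcmp b n c))"
      unfolding blocked_def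
      using T.cmp_assoc[OF RS(1) ca(1) ba] T.cmp_assoc[OF RS(1) T.cmp_closed[OF ca(1) ba] ca(2)]
        T.cmp_assoc[OF T.cmp_closed[OF T.cmp_closed[OF RS(1) ca(1)] ba] ca(2) RS(2)]
      by simp
    finally show ?thesis .
  qed
  then show ?thesis using B eq by metis
qed

lemma BB_mult:
  assumes "B \<in> braids n" "B' \<in> braids n"
  shows "blocked n B \<otimes>\<^bsub>BB n\<^esub> blocked n B' = blocked n (tcmp B n B')"
proof -
  interpret T: braided_strict_monoidal_category "Tangle n" by (rule Tangle_braided)
  note i = braids_ident[of n]
  have "blocked n (tcmp b n b') = blocked n (tcmp B n B')"
    if b: "b \<in> braids n" "b' \<in> braids n" "blocked n b = blocked n B" "blocked n b' = blocked n B'" for b b'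
  proof -
    note a = braids_arrow[OF b(1)] braids_arrow[OF b(2)] braids_arrow[OF assms(1)] braids_arrow[OF assms(2)]
    have "blocked n (tcmp b n b') = blocked n (tcmp B n b')"
      using blocked_cong[OF b(1) assms(1) b(2) i b(3)]
      by (simp del: Tangle_simps(4) add: T.ident_cmp[OF T.cmp_closed[OF a(2) a(1)]] T.ident_cmp[OF T.cmp_closed[OF a(2) a(3)]])
    also have "\<dots> = blocked n (tcmp B n B')"
      using blocked_cong[OF b(2) assms(2) i assms(1) b(4)]
      by (simp del: Tangle_simps(4) add: T.cmp_ident[OF a(2)] T.cmp_ident[OF a(4)])
    finally show ?thesis .
  qed
  then show ?thesis
    unfolding BB_def monoid.simps using assms by (intro the_equality) (blast, metis)
qed

lemma BB_group: "group (BB n)"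
proof -
  interpret T: braided_strict_monoidal_category "Tangle n" by (rule Tangle_braided)
  have c: "carrier (BB n) = blocked n ` braids n" and o: "\<one>\<^bsub>BB n\<^esub> = blocked n (ident (Tangle n) n)"
    by (simp_all add: BB_def)
  show ?thesis
  proof (rule groupI)
    fix x y z
    show "x \<in> carrier (BB n) \<Longrightarrow> y \<in> carrier (BB n) \<Longrightarrow> x \<otimes>\<^bsub>BB n\<^esub> y \<in> carrier (BB n)"
      by (auto simp: c BB_mult braids_cmp)
    show "\<one>\<^bsub>BB n\<^esub> \<in> carrier (BB n)" using braids_ident unfolding c o by blast
    show "x \<in> carrier (BB n) \<Longrightarrow> y \<in> carrier (BB n) \<Longrightarrow> z \<in> carrier (BB n) \<Longrightarrow>
       x \<otimes>\<^bsub>BB n\<^esub> y \<otimes>\<^bsub>BB n\<^esub> z = x \<otimes>\<^bsub>BB n\<^esub> (y \<otimes>\<^bsub>BB n\<^esub> z)"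
      by (auto simp: c BB_mult braids_cmp T.cmp_assoc[OF braids_arrow braids_arrow braids_arrow])
    show "x \<in> carrier (BB n) \<Longrightarrow> \<one>\<^bsub>BB n\<^esub> \<otimes>\<^bsub>BB n\<^esub> x = x"
      by (auto simp: c o BB_mult braids_ident T.ident_cmp[OF braids_arrow] simp del: Tangle_simps(4))
    show "x \<in> carrier (BB n) \<Longrightarrow> \<exists>y\<in>carrier (BB n). y \<otimes>\<^bsub>BB n\<^esub> x = \<one>\<^bsub>BB n\<^esub>"
      by (auto simp: c o BB_mult braids_inv simp del: Tangle_simps(4) intro!: bexI[OF _ braids_inv(1)])
  qed
qed

lemma BB_inv:
  assumes "B \<in> braids n"
  shows "inv\<^bsub>BB n\<^esub> (blocked n B) = blocked n (inv_arrow (Tangle n) B)"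
proof (rule group.inv_equality[OF BB_group])
  show "blocked n (inv_arrow (Tangle n) B) \<otimes>\<^bsub>BB n\<^esub> blocked n B = \<one>\<^bsub>BB n\<^esub>"
    using BB_mult[OF braids_inv(1)[OF assms] assms] by (simp add: braids_inv assms BB_def)
qed (use assms braids_inv(1) in \<open>auto simp: BB_def\<close>)

end

theory Submission
  imports Defs
begin

text \<open>Whiskering, that is, sending an arrow \<open>f\<close> to \<open>1 \<otimes> f \<otimes> 1\<close>, preserves composition and identities,
  so equations between the \<open>\<sigma>\<^sub>i\<close> need only be proved on the strings they move. Far-apart twists
  commute by the interchange law of the tensor functor. For the other equation the
  strings are \<open>A \<otimes> A \<otimes> A\<close>: naturality of \<open>\<tau>\<^bsub>A,A\<otimes>A\<^esub>\<close> along \<open>1 \<otimes> \<tau>\<^bsub>A,A\<^esub>\<close>, with \<open>\<tau>\<^bsub>A,A\<otimes>A\<^esub>\<close> expanded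
  by the hexagon law, is exactly the braid equation (\<open>yang_baxter\<close>).

  Multiplication of blocked braids is composition of the underlying braids, so the equations
  pass to \<open>BB n\<close> (\<open>blocked_sigma_braid_equations\<close>). As \<open>Artin n\<close> is presented by these equations,
  evaluating words gives a homomorphism into any group in which they hold (\<open>Artin_universal\<close>).

  For surjectivity it suffices that the \<open>S\<sigma>\<^sub>iR\<close> lie in no proper subgroup of \<open>BB n\<close>
  (\<open>BB_generated\<close>), since the image of the homomorphism is a subgroup containing them. A braid is
  a composite of tensor products of identities and twists or their inverses, and the interchange law
  spreads such a tensor product out into a composite in which one factor at a time acts and the other strings
  are straight; hence the \<open>\<sigma>\<^sub>i\<close> and their inverses generate all braids (\<open>braids_induct\<close>).\<close>

section \<open>Whiskering by tensor powers\<close>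

text \<open>The generators \<open>\<sigma>\<^sub>i\<close>, their inverses, and the factors of a tensor product all have this shape, with
  \<open>a\<close> straight strings on the left and \<open>b\<close> on the right, which makes one calculus serve
  both the braid equations and the decomposition of braids.\<close>

definition whisker :: "('o, 'a, 'm) braided_data_scheme \<Rightarrow> 'o \<Rightarrow> nat \<Rightarrow> 'a \<Rightarrow> nat \<Rightarrow> 'a" where
  "whisker C A a f b =
     tensor_ar C (ident C (tensor_power C A a)) (tensor_ar C f (ident C (tensor_power C A b)))"

lemma sigma_whisker: "sigma C A n i = whisker C A (i - 1) (twist C A A) (n - i - 1)"
  by (simp add: sigma_def whisker_def)

context strict_monoidal_category
begin

lemma arrows_imp_Ar: "f \<in> arrows C X Y \<Longrightarrow> f \<in> Ar C"
  by (simp add: arrows_def)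

text \<open>Both composites are instances of functoriality of \<open>\<star>\<close>: each factor is composed with an identity.\<close>

lemma interchange:
  assumes f: "f \<in> arrows C X X'" and g: "g \<in> arrows C Y Y'"
  shows "(f \<star> ident C Y') \<cdot> (ident C X \<star> g) = f \<star> g"
    and "(ident C X' \<star> g) \<cdot> (f \<star> ident C Y) = f \<star> g"
proof -
  have X: "X \<in> Ob C" "X' \<in> Ob C" and Y: "Y \<in> Ob C" "Y' \<in> Ob C"
    using f g src_closed tgt_closed by (auto simp: arrows_def)
  note i = ident_closed[OF X(1)] ident_closed[OF X(2)] ident_closed[OF Y(1)] ident_closed[OF Y(2)]
  show "(f \<star> ident C Y') \<cdot> (ident C X \<star> g) = f \<star> g"
    using tensor_cmp[OF i(1) f g i(4)] by (simp add: cmp_ident[OF f] ident_cmp[OF g])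
  show "(ident C X' \<star> g) \<cdot> (f \<star> ident C Y) = f \<star> g"
    using tensor_cmp[OF f i(2) i(3) g] by (simp add: cmp_ident[OF g] ident_cmp[OF f])
qed

context
  fixes A
  assumes A: "A \<in> Ob C"
begin

lemmas power_closed = tensor_power_closed[OF A]
lemmas power_add = tensor_power_add[OF A]
lemmas power_ident_closed = ident_closed[OF power_closed]
lemmas power_ident_Ar = arrows_imp_Ar[OF power_ident_closed]

lemma power_one: "tensor_power C A 1 = A"
  by (simp add: unit_tensor_ob A)

lemma power_two: "tensor_power C A 2 = A \<odot> A"
  by (simp add: numeral_2_eq_2 unit_tensor_ob A)

lemma power_ident_add:
  "ident C (tensor_power C A (k + l)) = ident C (tensor_power C A k) \<star> ident C (tensor_power C A l)"
  by (simp add: tensor_ident power_closed power_add)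

lemma whisker_arrow:
  assumes "f \<in> arrows C (tensor_power C A k) (tensor_power C A l)"
  shows "whisker C A a f b \<in> arrows C (tensor_power C A (a + k + b)) (tensor_power C A (a + l + b))"
  unfolding whisker_def power_add
  using tensor_ar_closed[OF power_ident_closed tensor_ar_closed[OF assms power_ident_closed]]
  by (simp add: tensor_ob_assoc power_closed)

lemma whisker_ident:
  "whisker C A a (ident C (tensor_power C A k)) b = ident C (tensor_power C A (a + k + b))"
  by (simp add: whisker_def power_ident_add tensor_ar_assoc power_ident_Ar)

lemma whisker_cmp:
  assumes g: "g \<in> arrows C X Y" and f: "f \<in> arrows C Y Z"
  shows "whisker C A a (f \<cdot> g) b = whisker C A a f b \<cdot> whisker C A a g b"
proof -
  have i: "ident C (tensor_power C A k) \<cdot> ident C (tensor_power C A k) = ident C (tensor_power C A k)"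
    for k by (rule cmp_ident[OF power_ident_closed])
  show ?thesis
    unfolding whisker_def
    using tensor_cmp[OF g f power_ident_closed power_ident_closed, of b]
      tensor_cmp[OF power_ident_closed power_ident_closed
        tensor_ar_closed[OF g power_ident_closed] tensor_ar_closed[OF f power_ident_closed], of a b]
    by (simp add: i)
qed

lemma whisker_whisker:
  assumes "f \<in> Ar C"
  shows "whisker C A a (whisker C A c f d) b = whisker C A (a + c) f (d + b)"
proof -
  have Ar: "g \<star> h \<in> Ar C" if "g \<in> Ar C" "h \<in> Ar C" for g h
    using that tensor_ar_closed[of g "src C g" "tgt C g" h "src C h" "tgt C h"]
    by (auto simp: arrows_def)
  show ?thesis
    by (simp add: whisker_def power_ident_add tensor_ar_assoc power_ident_Ar Ar assms)
qed

lemma whisker_zero: "f \<in> Ar C \<Longrightarrow> whisker C A 0 f 0 = f"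
  by (simp add: whisker_def tensor_ar_unit unit_tensor_ar)

text \<open>Arrows on disjoint groups of strings can be applied one after the other, in either order. Read
  as an equation between the two right-hand sides this is the far commutation of braids; read from left
  to right it breaks a tensor product into arrows that act on fewer strings.\<close>

lemma whisker_tensor:
  assumes f: "f \<in> arrows C (tensor_power C A k) (tensor_power C A k)"
    and g: "g \<in> arrows C (tensor_power C A l) (tensor_power C A l)"
  shows "whisker C A a (f \<star> g) b = whisker C A a f (l + b) \<cdot> whisker C A (a + k) g b"
    and "whisker C A a (f \<star> g) b = whisker C A (a + k) g b \<cdot> whisker C A a f (l + b)"
proof -
  let ?i = "\<lambda>k. ident C (tensor_power C A k)"
  have f': "f \<star> ?i l \<in> arrows C (tensor_power C A (k + l)) (tensor_power C A (k + l))"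
    and g': "?i k \<star> g \<in> arrows C (tensor_power C A (k + l)) (tensor_power C A (k + l))"
    using tensor_ar_closed[OF f power_ident_closed] tensor_ar_closed[OF power_ident_closed g]
    by (simp_all add: power_add)
  have wf: "whisker C A a (f \<star> ?i l) b = whisker C A a f (l + b)"
    using whisker_whisker[OF arrows_imp_Ar[OF f], of a 0 l b]
      unit_tensor_ar[OF arrows_imp_Ar[OF f']] by (simp add: whisker_def[of _ _ 0])
  have wg: "whisker C A a (?i k \<star> g) b = whisker C A (a + k) g b"
    using whisker_whisker[OF arrows_imp_Ar[OF g], of a k 0 b]
      tensor_ar_unit[OF arrows_imp_Ar[OF g]] by (simp add: whisker_def[of _ _ k])
  show "whisker C A a (f \<star> g) b = whisker C A a f (l + b) \<cdot> whisker C A (a + k) g b"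
    using whisker_cmp[OF g' f', of a b] by (simp only: interchange(1)[OF f g] wf wg)
  show "whisker C A a (f \<star> g) b = whisker C A (a + k) g b \<cdot> whisker C A a f (l + b)"
    using whisker_cmp[OF f' g', of a b] by (simp only: interchange(2)[OF f g] wf wg)
qed

end
end

section \<open>The braid equations in a braided strict monoidal category\<close>

context braided_strict_monoidal_category
begin

text \<open>Expanding \<open>\<tau>\<^bsub>A,A\<otimes>A\<^esub>\<close> as \<open>(i \<star> t) \<cdot> (t \<star> i)\<close>, this says that it does not matter whether two strings are
  twisted before or after a third one is moved past both of them.\<close>

lemma yang_baxter:
  assumes A: "A \<in> Ob C"
  defines "t \<equiv> twist C A A" and "i \<equiv> ident C A"
  shows "((t \<star> i) \<cdot> (i \<star> t)) \<cdot> (t \<star> i) = ((i \<star> t) \<cdot> (t \<star> i)) \<cdot> (i \<star> t)"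
proof -
  have t: "t \<in> arrows C (A \<odot> A) (A \<odot> A)" and i: "i \<in> arrows C A A"
    using twist_closed[OF A A] ident_closed[OF A] by (simp_all add: t_def i_def)
  have ti: "t \<star> i \<in> arrows C (A \<odot> A \<odot> A) (A \<odot> A \<odot> A)" and it: "i \<star> t \<in> arrows C (A \<odot> A \<odot> A) (A \<odot> A \<odot> A)"
    using tensor_ar_closed[OF t i] tensor_ar_closed[OF i t] by (simp_all add: tensor_ob_assoc A)
  have "((t \<star> i) \<cdot> (i \<star> t)) \<cdot> (t \<star> i) = (t \<star> i) \<cdot> ((i \<star> t) \<cdot> (t \<star> i))"
    by (rule cmp_assoc[OF ti it ti])
  also have "\<dots> = (t \<star> i) \<cdot> twist C A (A \<odot> A)"
    using twist_tensor_right[OF A A A] by (simp add: t_def i_def)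
  also have "\<dots> = twist C A (A \<odot> A) \<cdot> (i \<star> t)"
    by (rule twist_natural[OF i t, symmetric])
  also have "\<dots> = ((i \<star> t) \<cdot> (t \<star> i)) \<cdot> (i \<star> t)"
    using twist_tensor_right[OF A A A] by (simp add: t_def i_def)
  finally show ?thesis .
qed

lemma twist_power_arrow:
  "A \<in> Ob C \<Longrightarrow> twist C A A \<in> arrows C (tensor_power C A 2) (tensor_power C A 2)"
  using twist_closed by (simp add: power_two)

lemma sigma_arrow:
  assumes A: "A \<in> Ob C" and i: "1 \<le> i" "i < n"
  shows "sigma C A n i \<in> arrows C (tensor_power C A n) (tensor_power C A n)"
proof -
  have "i - 1 + 2 + (n - i - 1) = n" using i by simp
  then show ?thesis
    using whisker_arrow[OF A twist_power_arrow[OF A], of "i - 1" "n - i - 1"]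
    by (simp only: sigma_whisker)
qed

lemma sigma_commute:
  assumes A: "A \<in> Ob C" and ij: "1 \<le> i" "i + 1 < j" "j < n"
  shows "sigma C A n i \<cdot> sigma C A n j = sigma C A n j \<cdot> sigma C A n i"
proof -
  note t = twist_power_arrow[OF A]
  \<comment> \<open>Of the strings that \<open>\<sigma>\<^sub>i\<close> keeps straight, those on its right are the \<open>m\<close> strings between the two
    twists, then the two that \<open>\<sigma>\<^sub>j\<close> twists, then the \<open>n - j - 1\<close> last ones.\<close>
  define m where "m = j - i - 2"
  let ?w = "whisker C A m (twist C A A) 0"
  have w: "?w \<in> arrows C (tensor_power C A (m + 2)) (tensor_power C A (m + 2))"
    using whisker_arrow[OF A t, of m 0] by simp
  have "i + 1 + m = j - 1" using ij by (simp add: m_def)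
  then have "whisker C A (i + 1) ?w (n - j - 1) = sigma C A n j"
    using whisker_whisker[OF A arrows_imp_Ar[OF t], of "i + 1" m 0 "n - j - 1"]
    by (simp only: sigma_whisker add_0)
  moreover have "whisker C A (i - 1) (twist C A A) (m + 2 + (n - j - 1)) = sigma C A n i"
  proof -
    have "m + 2 + (n - j - 1) = n - i - 1" using ij by (simp add: m_def)
    then show ?thesis by (simp only: sigma_whisker)
  qed
  moreover have "i - 1 + 2 = i + 1" using ij by simp
  ultimately show ?thesis
    using whisker_tensor[OF A t w, of "i - 1" "n - j - 1"] by simp
qed

lemma sigma_braid:
  assumes A: "A \<in> Ob C" and i: "1 \<le> i" "i + 1 < n"
  shows "(sigma C A n i \<cdot> sigma C A n (i + 1)) \<cdot> sigma C A n i
       = (sigma C A n (i + 1) \<cdot> sigma C A n i) \<cdot> sigma C A n (i + 1)"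
proof -
  let ?t = "twist C A A" and ?i = "ident C A" and ?X = "A \<odot> A \<odot> A"
  let ?w = "\<lambda>f. whisker C A (i - 1) f (n - i - 2)"
  note t = twist_closed[OF A A] and i1 = ident_closed[OF A]
  have ti: "?t \<star> ?i \<in> arrows C ?X ?X" and it: "?i \<star> ?t \<in> arrows C ?X ?X"
    using tensor_ar_closed[OF t i1] tensor_ar_closed[OF i1 t] by (simp_all add: tensor_ob_assoc A)
  note tA = arrows_imp_Ar[OF t] and p1 = power_one[OF A]
  have n: "1 + (n - i - 2) = n - i - 1" "i - 1 + 1 = i" using i by simp_all
  have "?w (whisker C A 0 ?t 1) = whisker C A (i - 1) ?t (n - i - 1)"
    using whisker_whisker[OF A tA, of "i - 1" 0 1 "n - i - 2"] by (simp only: n add_0_right)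
  moreover have "whisker C A 0 ?t 1 = ?t \<star> ?i"
    unfolding whisker_def p1 using unit_tensor_ar[OF arrows_imp_Ar[OF ti]] by simp
  ultimately have s1: "?w (?t \<star> ?i) = sigma C A n i"
    by (simp add: sigma_whisker)
  have "?w (whisker C A 1 ?t 0) = whisker C A i ?t (n - i - 2)"
    using whisker_whisker[OF A tA, of "i - 1" 1 0 "n - i - 2"] by (simp only: n add_0)
  moreover have "whisker C A 1 ?t 0 = ?i \<star> ?t"
    unfolding whisker_def p1 using tensor_ar_unit[OF tA] by simp
  ultimately have s2: "?w (?i \<star> ?t) = sigma C A n (i + 1)"
    by (simp add: sigma_whisker numeral_2_eq_2)
  show ?thesis
    using arg_cong[OF yang_baxter[OF A], of ?w]
    by (simp only: whisker_cmp[OF A ti cmp_closed[OF it ti]] whisker_cmp[OF A it cmp_closed[OF ti it]]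
        whisker_cmp[OF A it ti] whisker_cmp[OF A ti it] s1 s2)
qed

lemma sigma_braid_equations: "A \<in> Ob C \<Longrightarrow> braid_equations (cmp C) n (sigma C A n)"
  unfolding braid_equations_def
  by (intro conjI allI impI; elim conjE; rule sigma_commute sigma_braid) assumption+

end

section \<open>The universal property of Artin's braid group\<close>

lemma braid_words_simps [simp]:
  "[] \<in> braid_words n"
  "x # w \<in> braid_words n \<longleftrightarrow> 1 \<le> fst x \<and> fst x < n \<and> w \<in> braid_words n"
  "v @ w \<in> braid_words n \<longleftrightarrow> v \<in> braid_words n \<and> w \<in> braid_words n"
  by (cases x; auto simp: braid_words_def)+

text \<open>The congruence relates only words in the letters \<open>1, \<dots>, n - 1\<close>, so a value computed from a representative
  of a class never involves a generator out of range.\<close>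

lemma artin_eq_words: "artin_eq n v w \<Longrightarrow> v \<in> braid_words n \<and> w \<in> braid_words n"
  by (induction rule: artin_eq.induct) auto

lemma artin_class_eqI: "artin_eq n v w \<Longrightarrow> artin_class n v = artin_class n w"
  unfolding artin_class_def by (blast intro: artin_eq.sym artin_eq.trans)

lemma artin_class_self: "w \<in> braid_words n \<Longrightarrow> w \<in> artin_class n w"
  by (simp add: artin_class_def artin_eq.refl)

lemma Artin_mult:
  assumes "v \<in> braid_words n" "w \<in> braid_words n"
  shows "artin_class n v \<otimes>\<^bsub>Artin n\<^esub> artin_class n w = artin_class n (v @ w)"
proof -
  have "artin_class n (v' @ w') = artin_class n (v @ w)"
    if "v' \<in> artin_class n v" "w' \<in> artin_class n w" for v' w'
    using artin_class_eqI[OF artin_eq.cong, of n v v' w w'] that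
    unfolding artin_class_def mem_Collect_eq by simp
  then have "artin_class n v \<otimes>\<^bsub>Artin n\<^esub> artin_class n w
      = (\<Union>v'\<in>artin_class n v. \<Union>w'\<in>artin_class n w. artin_class n (v @ w))"
    unfolding Artin_def monoid.simps by (intro SUP_cong HOL.refl) blast
  then show ?thesis using artin_class_self[OF assms(1)] artin_class_self[OF assms(2)] by auto
qed

definition formal_inverse :: "braid_word \<Rightarrow> braid_word" where
  "formal_inverse w = rev (map (\<lambda>(i, b). (i, \<not> b)) w)"

lemma formal_inverse_words: "w \<in> braid_words n \<Longrightarrow> formal_inverse w \<in> braid_words n"
  by (induction w) (auto simp: formal_inverse_def)

text \<open>The last letter of the formal inverse meets the first letter of \<open>w\<close>, so cancellation proceeds from
  the middle outwards.\<close>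

lemma formal_inverse_cancel: "w \<in> braid_words n \<Longrightarrow> artin_eq n (formal_inverse w @ w) []"
proof (induction w)
  case Nil then show ?case by (simp add: formal_inverse_def artin_eq.refl)
next
  case (Cons x w)
  obtain i b where x: "x = (i, b)" by fastforce
  with Cons.prems have i: "1 \<le> i" "i < n" and w: "w \<in> braid_words n" by auto
  note u = artin_eq.refl[OF formal_inverse_words[OF w]] and w' = artin_eq.refl[OF w]
  have "artin_eq n [(i, \<not> b), (i, b)] []" using artin_eq.cancel[OF i, of "\<not> b"] by simp
  from artin_eq.cong[OF u artin_eq.cong[OF this w']]
  have "artin_eq n (formal_inverse (x # w) @ x # w) (formal_inverse w @ w)"
    by (simp add: formal_inverse_def x)
  then show ?case using Cons.IH[OF w] by (rule artin_eq.trans)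
qed

lemma Artin_group: "group (Artin n)"
proof -
  have c: "carrier (Artin n) = artin_class n ` braid_words n" and o: "\<one>\<^bsub>Artin n\<^esub> = artin_class n []"
    by (simp_all add: Artin_def)
  show ?thesis
  proof (rule groupI)
    fix x
    assume "x \<in> carrier (Artin n)"
    then obtain w where w: "w \<in> braid_words n" "x = artin_class n w" by (auto simp: c)
    then have "artin_class n (formal_inverse w) \<otimes>\<^bsub>Artin n\<^esub> x = \<one>\<^bsub>Artin n\<^esub>"
      using artin_class_eqI[OF formal_inverse_cancel[OF w(1)]]
      by (simp add: Artin_mult formal_inverse_words o)
    then show "\<exists>y\<in>carrier (Artin n). y \<otimes>\<^bsub>Artin n\<^esub> x = \<one>\<^bsub>Artin n\<^esub>"
      using formal_inverse_words[OF w(1)] unfolding c by blast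
  qed (auto simp: c o Artin_mult)
qed

definition word_value :: "('g, 'm) monoid_scheme \<Rightarrow> (nat \<Rightarrow> 'g) \<Rightarrow> braid_word \<Rightarrow> 'g" where
  "word_value G s w =
     foldr (\<lambda>(i, b) x. (if b then s i else inv\<^bsub>G\<^esub> s i) \<otimes>\<^bsub>G\<^esub> x) w \<one>\<^bsub>G\<^esub>"

lemma word_value_simps [simp]:
  "word_value G s [] = \<one>\<^bsub>G\<^esub>"
  "word_value G s ((i, b) # w) = (if b then s i else inv\<^bsub>G\<^esub> s i) \<otimes>\<^bsub>G\<^esub> word_value G s w"
  by (simp_all add: word_value_def)

context group
begin

context
  fixes n :: nat and s :: "nat \<Rightarrow> 'a"
  assumes s: "\<And>i. \<lbrakk>1 \<le> i; i < n\<rbrakk> \<Longrightarrow> s i \<in> carrier G"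
begin

lemma word_value_closed: "w \<in> braid_words n \<Longrightarrow> word_value G s w \<in> carrier G"
  by (induction w) (auto simp: s)

lemma word_value_append:
  "\<lbrakk>v \<in> braid_words n; w \<in> braid_words n\<rbrakk>
   \<Longrightarrow> word_value G s (v @ w) = word_value G s v \<otimes> word_value G s w"
  by (induction v) (auto simp: s word_value_closed m_assoc)

lemma word_value_cong:
  assumes eqs: "braid_equations (mult G) n s"
  shows "artin_eq n v w \<Longrightarrow> word_value G s v = word_value G s w"
proof (induction rule: artin_eq.induct)
  case (cong v v' w w')
  then show ?case using artin_eq_words by (simp add: word_value_append)
next
  case (cancel i b)
  then show ?case using s[of i] by auto
next
  case (commute i j)
  then have "s i \<otimes> s j = s j \<otimes> s i" using eqs unfolding braid_equations_def by blast
  then show ?case using commute s[of i] s[of j] by simp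
next
  case (braid i)
  then have "(s i \<otimes> s (i + 1)) \<otimes> s i = (s (i + 1) \<otimes> s i) \<otimes> s (i + 1)"
    using eqs unfolding braid_equations_def by blast
  then show ?case using braid s[of i] s[of "i + 1"] by (simp add: m_assoc)
qed auto

text \<open>The value of a word is constant on its class because each defining relation of \<open>artin_eq\<close> holds
  in \<open>G\<close>; hence picking the only element of the image of a class defines a function on \<open>Artin n\<close>.\<close>

lemma Artin_universal:
  assumes eqs: "braid_equations (mult G) n s"
  obtains h where "group_hom (Artin n) G h"
    "\<And>i. \<lbrakk>1 \<le> i; i < n\<rbrakk> \<Longrightarrow> h (artin_gen n i) = s i"
proof
  let ?h = "\<lambda>x. the_elem (word_value G s ` x)"
  have h: "?h (artin_class n w) = word_value G s w" if w: "w \<in> braid_words n" for w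
  proof -
    have "word_value G s v = word_value G s w" if "v \<in> artin_class n w" for v
      using that word_value_cong[OF eqs, of w v] by (simp add: artin_class_def)
    then have "word_value G s ` artin_class n w = {word_value G s w}"
      using artin_class_self[OF w] by blast
    then show ?thesis by simp
  qed
  have "?h \<in> hom (Artin n) G"
  proof (rule homI)
    fix x y
    assume "x \<in> carrier (Artin n)" "y \<in> carrier (Artin n)"
    then obtain v w where vw: "v \<in> braid_words n" "w \<in> braid_words n"
        "x = artin_class n v" "y = artin_class n w"
      by (auto simp: Artin_def)
    then show "?h (x \<otimes>\<^bsub>Artin n\<^esub> y) = ?h x \<otimes> ?h y"
      by (simp add: Artin_mult h word_value_append)
  qed (auto simp: Artin_def h word_value_closed)
  then show "group_hom (Artin n) G ?h"
    using Artin_group is_group by (simp add: group_hom_def group_hom_axioms_def)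
  show "?h (artin_gen n i) = s i" if "1 \<le> i" "i < n" for i
    using that s by (simp add: artin_gen_def h)
qed

end
end

section \<open>Braids are generated by the twists and their inverses\<close>

lemma sigma_braids:
  assumes "1 \<le> i" "i < n"
  shows "sigma (Tangle n) 1 n i \<in> braids n"
proof -
  interpret T: braided_strict_monoidal_category "Tangle n" by (rule Tangle_braided)
  have "sigma (Tangle n) 1 n i \<in> braid_layers (Tangle n) 1"
    unfolding sigma_def by (intro braid_layers.intros)
  then show ?thesis
    using T.sigma_arrow[of 1 i n] assms by (simp add: braids_def braid_composites.intros(1) del: One_nat_def)
qed

lemma inv_arrow_sigma:
  assumes "1 \<le> i" "i < n"
  shows "inv_arrow (Tangle n) (sigma (Tangle n) 1 n i)
    = whisker (Tangle n) 1 (i - 1) (inv_arrow (Tangle n) (twist (Tangle n) 1 1)) (n - i - 1)"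
proof (rule category.inv_arrow_eq)
  interpret T: braided_strict_monoidal_category "Tangle n" by (rule Tangle_braided)
  show "category (Tangle n)" by (rule T.category_axioms)
  let ?P = "tensor_power (Tangle n) 1" and ?t = "twist (Tangle n) 1 1"
  let ?u = "inv_arrow (Tangle n) ?t" and ?w = "\<lambda>f. whisker (Tangle n) 1 (i - 1) f (n - i - 1)"
  have A: "1 \<in> Ob (Tangle n)" by simp
  note inv = T.inv_twist[OF A A, folded T.power_two[OF A]]
  have t: "?t \<in> arrows (Tangle n) (?P 2) (?P 2)" and u: "?u \<in> arrows (Tangle n) (?P 2) (?P 2)"
    by (rule T.twist_power_arrow[OF A], rule inv(1))
  note ar = T.whisker_arrow[OF A t, of "i - 1" "n - i - 1"] T.whisker_arrow[OF A u, of "i - 1" "n - i - 1"]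
  have "tcmp (?w ?u) n (?w ?t) = ident (Tangle n) (?P (i - 1 + 2 + (n - i - 1)))"
    by (simp only: T.whisker_cmp[OF A t u, symmetric] inv T.whisker_ident[OF A])
  moreover have "tcmp (?w ?t) n (?w ?u) = ident (Tangle n) (?P (i - 1 + 2 + (n - i - 1)))"
    by (simp only: T.whisker_cmp[OF A u t, symmetric] inv T.whisker_ident[OF A])
  ultimately show "inverse_arrows (Tangle n) (sigma (Tangle n) 1 n i) (?w ?u)"
    unfolding sigma_whisker by (rule inverse_arrowsI[OF ar])
qed

text \<open>Induction on layers needs the stronger claim about every way of whiskering a layer to \<open>n\<close> strings:
  a tensor product of two layers is then a composite of two whiskered layers, and a whiskered
  twist is a \<open>\<sigma>\<^sub>i\<close>. A composite is then split into factors on \<open>n\<close> strings, since every factor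
  has the same source and target.\<close>

lemma braids_induct [consumes 1, case_names ident sigma inv_sigma cmp]:
  assumes B: "B \<in> braids n"
    and ident: "P (ident (Tangle n) n)"
    and sigma: "\<And>i. \<lbrakk>1 \<le> i; i < n\<rbrakk> \<Longrightarrow> P (sigma (Tangle n) 1 n i)"
    and inv_sigma: "\<And>i. \<lbrakk>1 \<le> i; i < n\<rbrakk> \<Longrightarrow> P (inv_arrow (Tangle n) (sigma (Tangle n) 1 n i))"
    and cmp: "\<And>B B'. \<lbrakk>B \<in> braids n; P B; B' \<in> braids n; P B'\<rbrakk> \<Longrightarrow> P (tcmp B n B')"
  shows "P B"
proof -
  interpret T: braided_strict_monoidal_category "Tangle n" by (rule Tangle_braided)
  have A: "1 \<in> Ob (Tangle n)" by simp
  let ?w = "\<lambda>a f b. whisker (Tangle n) 1 a f b"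
  have whisker_braids: "?w a f b \<in> braids n"
    if "f \<in> braid_layers (Tangle n) 1" "f \<in> arrows (Tangle n) k k" "a + k + b = n" for f a b k
  proof -
    have "?w a f b \<in> braid_layers (Tangle n) 1"
      unfolding whisker_def by (intro braid_layers.intros that)
    moreover have "?w a f b \<in> arrows (Tangle n) n n"
      using T.whisker_arrow[OF A, of f k k a b] that by (simp del: One_nat_def)
    ultimately show ?thesis by (simp add: braids_def braid_composites.intros(1))
  qed
  have layer: "P (?w a f b)"
    if "f \<in> braid_layers (Tangle n) 1" "f \<in> arrows (Tangle n) k k" "a + k + b = n" for f a b k
    using that
  proof (induction arbitrary: a b k rule: braid_layers.induct)
    case (1 l)
    then have "l = k"
      using T.ident_closed[of "tensor_power (Tangle n) 1 l"] by (auto simp: arrows_def)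
    then show ?case
      using ident "1.prems"(2) T.whisker_ident[OF A, of a l b] by (simp only: tensor_power_Tangle)
  next
    case 2
    then have "k = 2" using T.twist_closed[OF A A] by (auto simp: arrows_def)
    \<comment> \<open>With \<open>a\<close> strings on the left, the twist acts on strings \<open>a + 1\<close> and \<open>a + 2\<close>.\<close>
    with 2 have "a + 1 - 1 = a" "n - (a + 1) - 1 = b" "1 \<le> a + 1" "a + 1 < n" by auto
    then show ?case using sigma[of "a + 1"] by (simp only: sigma_whisker)
  next
    case 3
    then have "k = 2" using T.inv_twist(1)[OF A A] by (auto simp: arrows_def)
    with 3 have "a + 1 - 1 = a" "n - (a + 1) - 1 = b" "1 \<le> a + 1" "a + 1 < n" by auto
    then show ?case using inv_sigma[of "a + 1"] by (simp only: inv_arrow_sigma)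
  next
    case (4 f g)
    obtain l m where lm: "f \<in> arrows (Tangle n) l l" "g \<in> arrows (Tangle n) m m"
      using braid_layer_arrow "4.hyps" by meson
    have "k = l + m"
      using T.tensor_ar_closed[OF lm] "4.prems"(1) by (auto simp: arrows_def)
    then have s: "a + l + (m + b) = n" "(a + l) + m + b = n" using "4.prems"(2) by auto
    have "?w a (tensor_ar (Tangle n) f g) b = tcmp (?w a f (m + b)) n (?w (a + l) g b)"
      using T.whisker_tensor(1)[OF A, of f l g m a b] lm by (simp del: One_nat_def)
    then show ?case
      using cmp[OF whisker_braids[OF "4.hyps"(1) lm(1) s(1)] "4.IH"(1)[OF lm(1) s(1)]
          whisker_braids[OF "4.hyps"(2) lm(2) s(2)] "4.IH"(2)[OF lm(2) s(2)]] by simp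
  qed
  have "f \<in> arrows (Tangle n) n n \<Longrightarrow> P f" if "f \<in> braid_composites (Tangle n) 1" for f
    using that
  proof (induction rule: braid_composites.induct)
    case (1 f)
    then show ?case using layer[of f n 0 0] T.whisker_zero[OF A T.arrows_imp_Ar] by (simp del: One_nat_def)
  next
    case (2 f g)
    obtain k l where "f \<in> arrows (Tangle n) k k" "g \<in> arrows (Tangle n) l l"
      using braid_composite_arrow "2.hyps"(1,2) by meson
    moreover from this have "l = k" using "2.hyps"(3) by (auto simp: arrows_def)
    ultimately have "f \<in> arrows (Tangle n) n n" "g \<in> arrows (Tangle n) n n"
      using T.cmp_closed[of g k k f k] "2.prems" by (auto simp: arrows_def)
    with 2 show ?case by (intro cmp) (auto simp: braids_def)
  qed
  then show ?thesis using B by (simp add: braids_def)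
qed

section \<open>From the braid group onto the blocked-braid group\<close>

lemma blocked_sigma_carrier:
  "\<lbrakk>1 \<le> i; i < n\<rbrakk> \<Longrightarrow> blocked n (sigma (Tangle n) 1 n i) \<in> carrier (BB n)"
  using sigma_braids by (auto simp: BB_def simp del: One_nat_def)

lemma blocked_sigma_braid_equations:
  "braid_equations (mult (BB n)) n (\<lambda>i. blocked n (sigma (Tangle n) 1 n i))"
proof -
  interpret T: braided_strict_monoidal_category "Tangle n" by (rule Tangle_braided)
  let ?s = "sigma (Tangle n) 1 n"
  have "braid_equations (cmp (Tangle n)) n ?s"
    by (rule T.sigma_braid_equations) simp
  note eqs = this[unfolded braid_equations_def]
  have commute: "tcmp (?s i) n (?s j) = tcmp (?s j) n (?s i)" if "1 \<le> i" "i + 1 < j" "j < n" for i j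
    using that eqs by blast
  have braid: "tcmp (tcmp (?s i) n (?s (i + 1))) n (?s i) = tcmp (tcmp (?s (i + 1)) n (?s i)) n (?s (i + 1))"
    if "1 \<le> i" "i + 1 < n" for i
    using that eqs by blast
  show ?thesis
    unfolding braid_equations_def
  proof (intro conjI allI impI; elim conjE)
    fix i j
    assume "1 \<le> i" "i + 1 < j" "j < n"
    then show "blocked n (?s i) \<otimes>\<^bsub>BB n\<^esub> blocked n (?s j) = blocked n (?s j) \<otimes>\<^bsub>BB n\<^esub> blocked n (?s i)"
      using arg_cong[OF commute, of i j "blocked n"] by (simp add: BB_mult sigma_braids del: One_nat_def)
  next
    fix i
    assume "1 \<le> i" "i + 1 < n"
    then show "blocked n (?s i) \<otimes>\<^bsub>BB n\<^esub> blocked n (?s (i + 1)) \<otimes>\<^bsub>BB n\<^esub> blocked n (?s i)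
        = blocked n (?s (i + 1)) \<otimes>\<^bsub>BB n\<^esub> blocked n (?s i) \<otimes>\<^bsub>BB n\<^esub> blocked n (?s (i + 1))"
      using arg_cong[OF braid, of i "blocked n"]
      by (simp add: BB_mult sigma_braids braids_cmp del: One_nat_def)
  qed
qed

text \<open>Inverses of blocked braids are blocked inverses, so the induction over braids by \<open>\<sigma>\<^sub>i\<close>, their
  inverses and composites stays inside any subgroup that contains the blocked \<open>\<sigma>\<^sub>i\<close>.\<close>

lemma BB_generated:
  assumes H: "subgroup H (BB n)"
    and gen: "\<And>i. \<lbrakk>1 \<le> i; i < n\<rbrakk> \<Longrightarrow> blocked n (sigma (Tangle n) 1 n i) \<in> H"
  shows "carrier (BB n) \<subseteq> H"
proof -
  have "blocked n B \<in> H" if "B \<in> braids n" for B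
    using that
  proof (induction rule: braids_induct)
    case ident
    then show ?case using subgroup.one_closed[OF H] by (simp add: BB_def)
  next
    case (sigma i)
    then show ?case by (rule gen)
  next
    case (inv_sigma i)
    then show ?case
      using subgroup.m_inv_closed[OF H gen] by (simp add: BB_inv sigma_braids del: One_nat_def)
  next
    case (cmp B B')
    then show ?case using subgroup.m_closed[OF H, of "blocked n B" "blocked n B'"] by (simp add: BB_mult)
  qed
  then show ?thesis by (auto simp: BB_def)
qed

theorem proposition2p1:
  fixes n :: nat and C :: "('o, 'a) braided_data" and A :: 'o
  assumes "n \<ge> 1"
  shows
    "(braided_strict_monoidal_category C \<and> A \<in> Ob C \<longrightarrow>
        (\<forall>i. 1 \<le> i \<and> i < n \<longrightarrow>
           sigma C A n i \<in> arrows C (tensor_power C A n) (tensor_power C A n)) \<and>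
        braid_equations (cmp C) n (sigma C A n)) \<and>
     braid_equations (cmp (Tangle n)) n (sigma (Tangle n) 1 n) \<and>
     (\<forall>i. 1 \<le> i \<and> i < n \<longrightarrow> blocked n (sigma (Tangle n) 1 n i) \<in> carrier (BB n)) \<and>
     braid_equations (mult (BB n)) n (\<lambda>i. blocked n (sigma (Tangle n) 1 n i)) \<and>
     (\<exists>h. group_hom (Artin n) (BB n) h \<and> h ` carrier (Artin n) = carrier (BB n) \<and>
        (\<forall>i. 1 \<le> i \<and> i < n \<longrightarrow> h (artin_gen n i) = blocked n (sigma (Tangle n) 1 n i)))"
proof (intro conjI)
  interpret T: braided_strict_monoidal_category "Tangle n" by (rule Tangle_braided)
  show "braided_strict_monoidal_category C \<and> A \<in> Ob C \<longrightarrow>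
        (\<forall>i. 1 \<le> i \<and> i < n \<longrightarrow>
           sigma C A n i \<in> arrows C (tensor_power C A n) (tensor_power C A n)) \<and>
        braid_equations (cmp C) n (sigma C A n)"
    by (intro impI conjI allI; elim conjE;
        rule braided_strict_monoidal_category.sigma_arrow
          braided_strict_monoidal_category.sigma_braid_equations) assumption+
  show "braid_equations (cmp (Tangle n)) n (sigma (Tangle n) 1 n)"
    by (rule T.sigma_braid_equations) simp
  show "\<forall>i. 1 \<le> i \<and> i < n \<longrightarrow> blocked n (sigma (Tangle n) 1 n i) \<in> carrier (BB n)"
    using blocked_sigma_carrier by blast
  show eqs: "braid_equations (mult (BB n)) n (\<lambda>i. blocked n (sigma (Tangle n) 1 n i))"
    by (rule blocked_sigma_braid_equations)
  obtain h where h: "group_hom (Artin n) (BB n) h"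
    and gen: "\<And>i. \<lbrakk>1 \<le> i; i < n\<rbrakk> \<Longrightarrow> h (artin_gen n i) = blocked n (sigma (Tangle n) 1 n i)"
    using group.Artin_universal[OF BB_group blocked_sigma_carrier eqs] by blast
  interpret h: group_hom "Artin n" "BB n" h by (rule h)
  have "artin_gen n i \<in> carrier (Artin n)" if "1 \<le> i" "i < n" for i
    using that by (simp add: artin_gen_def Artin_def)
  then have "carrier (BB n) \<subseteq> h ` carrier (Artin n)"
    using gen by (intro BB_generated h.img_is_subgroup) (metis image_eqI)
  then have "h ` carrier (Artin n) = carrier (BB n)" by auto
  then show "\<exists>h. group_hom (Artin n) (BB n) h \<and> h ` carrier (Artin n) = carrier (BB n) \<and>
        (\<forall>i. 1 \<le> i \<and> i < n \<longrightarrow> h (artin_gen n i) = blocked n (sigma (Tangle n) 1 n i))"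
    using h gen by blast
qed

end
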